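(* Let $\widetilde{\mathcal U}$ be a nonempty bounded subset of $\mathcal U_p=L^p(0,T;U)$ whose closed convex hull $\overline{\mathrm{co}}\,\widetilde{\mathcal U}$ has at least one interior point in $\mathcal U_p$. Set $$M=\big\{\, y(T)\in Y \ :\ y \text{ is the mild solution to } y_t(t)=Ay(t)+F(t)y(t)+B(t)u(t),\ t\in(0,T],\ y(0)=0,\ \text{ for some } u(\cdot)\in\widetilde{\mathcal U}\,\big\}.$$ Then the following two assertions are equivalent: (1) The control system $y_t(t)=Ay(t)+F(t)y(t)+B(t)u(t)$, $t\in(0,T]$, $y(0)=0$, with controls $u(\cdot)\in\mathcal U_p$, is finite codimensional exactly controllable in $Y$ (at time $T$). (2) The set $M$ is finite codimensional in $Y$.
   Context: $T>0$; $Y$ and $U$ are reflexive (real) Banach spaces; $p\in(1,\infty]$; $\mathcal U_p=L^p(0,T;U)$. $A:\mathcal D(A)\subseteq Y\to Y$ generates a $C_0$-semigroup on $Y$, $F(\cdot)\in L^\infty(0,T;\mathcal L(Y))$, $B(\cdot)\in L^\infty(0,T;\mathcal L(U;Y))$. $A+F(\cdot)$ generates an evolution operator $\mathcal S(\cdot,\cdot)$ on $Y$, and the mild solution with $y(0)=0$ and control $u$ is $y(t)=\int_0^t\mathcal S(t,s)B(s)u(s)\,ds$. Finite codimensional subspace: a linear subspace $Y_0$ of a Banach space $Z$ is called finite codimensional (in $Z$) if there are $m\ge 0$ and linearly independent $z_1,\dots,z_m\in Z\setminus Y_0$ such that $Y_0$ and $z_1,\dots,z_m$ together linearly span $Z$.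 Finite codimensional set: a subset $D$ of $Y$ is called finite codimensional in $Y$ if there exists $y_0\in\overline{\mathrm{co}}\,D$ (closed convex hull) such that the closed linear span of $D-y_0$ is a finite codimensional subspace of $Y$, and $\overline{\mathrm{co}}\,(D-y_0)$ has at least one interior point relative to this closed subspace. Finite codimensional exact controllability: the system is finite codimensional exactly controllable at time $T$ if the reachable set $\mathcal R(T;0)=\{y(T): y \text{ is the mild solution with } y(0)=0 \text{ for some } u\in\mathcal U_p\}$ is a finite codimensional subspace of $Y$. *)

theory Defs
  imports
    "HOL-Analysis.Analysis"
    "HOL-Library.Function_Algebras"
    "HOL-Probability.Essential_Supremum"
begin

text \<open>Functions form a real vector space pointwise, so that the library's \<open>convex hull\<close> applies to
  sets of controls.\<close>

instantiation "fun" :: (type, real_vector) real_vector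
begin

definition scaleR_fun :: "real \<Rightarrow> ('a \<Rightarrow> 'b) \<Rightarrow> 'a \<Rightarrow> 'b"
  where "scaleR_fun c f = (\<lambda>x. c *\<^sub>R f x)"

instance
  by standard (auto simp: scaleR_fun_def fun_eq_iff algebra_simps)

end


section \<open>Bochner integration without separability\<close>

text \<open>The library's \<open>has_bochner_integral\<close> needs a second countable target. The Banach spaces here
  need not be separable, so Borel measurability is replaced by strong (Bochner) measurability; the
  rest of the definition is the library's.\<close>

definition strongly_measurable :: "'a measure \<Rightarrow> ('a \<Rightarrow> 'b::real_normed_vector) \<Rightarrow> bool" where
  "strongly_measurable M f \<longleftrightarrow>
     (\<exists>s :: nat \<Rightarrow> 'a \<Rightarrow> 'b. (\<forall>i. simple_function M (s i)) \<and>
        (AE x in M. (\<lambda>i. s i x) \<longlonglongrightarrow> f x))"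

definition has_strong_bochner_integral ::
    "'a measure \<Rightarrow> ('a \<Rightarrow> 'b::real_normed_vector) \<Rightarrow> 'b \<Rightarrow> bool" where
  "has_strong_bochner_integral M f x \<longleftrightarrow>
     strongly_measurable M f \<and>
     (\<exists>s. (\<forall>i. Bochner_Integration.simple_bochner_integrable M (s i)) \<and>
          (\<lambda>i. \<integral>\<^sup>+ t. ennreal (norm (f t - s i t)) \<partial>M) \<longlonglongrightarrow> 0 \<and>
          (\<lambda>i. Bochner_Integration.simple_bochner_integral M (s i)) \<longlonglongrightarrow> x)"


section \<open>Lebesgue--Bochner spaces\<close>

text \<open>Elements of $L^p(M;X)$ are represented by functions, and $L^p$ is treated as a seminormed space;
  all notions below are invariant under changing functions on null sets.\<close>

definition Lp_space :: "'a measure \<Rightarrow> ereal \<Rightarrow> ('a \<Rightarrow> 'b::real_normed_vector) set" where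
  "Lp_space M p =
     {u. strongly_measurable M u \<and>
         (if p = \<infinity> then esssup M (\<lambda>t. ereal (norm (u t))) < \<infinity>
          else integrable M (\<lambda>t. norm (u t) powr real_of_ereal p))}"

definition Lp_norm :: "'a measure \<Rightarrow> ereal \<Rightarrow> ('a \<Rightarrow> 'b::real_normed_vector) \<Rightarrow> real" where
  "Lp_norm M p u =
     (if p = \<infinity> then real_of_ereal (esssup M (\<lambda>t. ereal (norm (u t))))
      else (LINT t|M. norm (u t) powr real_of_ereal p) powr (1 / real_of_ereal p))"

definition Lp_bounded :: "'a measure \<Rightarrow> ereal \<Rightarrow> ('a \<Rightarrow> 'b::real_normed_vector) set \<Rightarrow> bool" where
  "Lp_bounded M p V \<longleftrightarrow> (\<exists>C. \<forall>u\<in>V. Lp_norm M p u \<le> C)"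

definition Lp_closure ::
    "'a measure \<Rightarrow> ereal \<Rightarrow> ('a \<Rightarrow> 'b::real_normed_vector) set \<Rightarrow> ('a \<Rightarrow> 'b) set" where
  "Lp_closure M p V =
     {u \<in> Lp_space M p. \<forall>e>0. \<exists>v\<in>V. Lp_norm M p (u - v) < e}"

definition Lp_interior ::
    "'a measure \<Rightarrow> ereal \<Rightarrow> ('a \<Rightarrow> 'b::real_normed_vector) set \<Rightarrow> ('a \<Rightarrow> 'b) set" where
  "Lp_interior M p V =
     {u \<in> Lp_space M p. \<exists>r>0. \<forall>v \<in> Lp_space M p. Lp_norm M p (v - u) < r \<longrightarrow> v \<in> V}"


section \<open>Reflexivity, finite codimension\<close>

definition reflexive_space :: "'a::real_normed_vector itself \<Rightarrow> bool" where
  "reflexive_space _ \<longleftrightarrow>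
     (\<forall>\<phi> :: ('a \<Rightarrow>\<^sub>L real) \<Rightarrow>\<^sub>L real. \<exists>x. \<forall>f. blinfun_apply \<phi> f = blinfun_apply f x)"

definition finite_codim_subspace :: "'a::real_vector set \<Rightarrow> bool" where
  "finite_codim_subspace Y\<^sub>0 \<longleftrightarrow>
     subspace Y\<^sub>0 \<and>
     (\<exists>Z. finite Z \<and> independent Z \<and> Z \<inter> Y\<^sub>0 = {} \<and> span (Y\<^sub>0 \<union> Z) = UNIV)"

definition finite_codim_set :: "'a::real_normed_vector set \<Rightarrow> bool" where
  "finite_codim_set D \<longleftrightarrow>
     (\<exists>y\<^sub>0 \<in> closure (convex hull D).
        let D' = (\<lambda>x. x - y\<^sub>0) ` D; L = closure (span D') in
        finite_codim_subspace L \<and>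
        (top_of_set L) interior_of (closure (convex hull D')) \<noteq> {})"


section \<open>Semigroups, evolution operators, mild solutions\<close>

definition C0_semigroup :: "(real \<Rightarrow> 'y \<Rightarrow>\<^sub>L 'y::real_normed_vector) \<Rightarrow> bool" where
  "C0_semigroup G \<longleftrightarrow>
     G 0 = id_blinfun \<and>
     (\<forall>s\<ge>0. \<forall>t\<ge>0. G (s + t) = G s o\<^sub>L G t) \<and>
     (\<forall>y. ((\<lambda>t. G t y) \<longlongrightarrow> y) (at_right 0))"

text \<open>The unbounded operator with domain \<open>DA\<close> is the restriction of \<open>A\<close> to \<open>DA\<close>; values of \<open>A\<close>
  outside \<open>DA\<close> are irrelevant.\<close>

definition generates_C0_semigroup ::
    "'y set \<Rightarrow> ('y \<Rightarrow> 'y) \<Rightarrow> (real \<Rightarrow> 'y \<Rightarrow>\<^sub>L 'y::real_normed_vector) \<Rightarrow> bool" where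
  "generates_C0_semigroup DA A G \<longleftrightarrow>
     C0_semigroup G \<and>
     DA = {y. \<exists>z. ((\<lambda>h. (1 / h) *\<^sub>R (G h y - y)) \<longlongrightarrow> z) (at_right 0)} \<and>
     (\<forall>y\<in>DA. ((\<lambda>h. (1 / h) *\<^sub>R (G h y - y)) \<longlongrightarrow> A y) (at_right 0))"

definition evolution_operator :: "real \<Rightarrow> (real \<Rightarrow> real \<Rightarrow> 'y \<Rightarrow>\<^sub>L 'y::real_normed_vector) \<Rightarrow> bool" where
  "evolution_operator T S \<longleftrightarrow>
     (\<forall>s\<in>{0..T}. S s s = id_blinfun) \<and>
     (\<forall>s r t. 0 \<le> s \<and> s \<le> r \<and> r \<le> t \<and> t \<le> T \<longrightarrow> S t s = S t r o\<^sub>L S r s) \<and>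
     (\<forall>y. continuous_on {(t, s). 0 \<le> s \<and> s \<le> t \<and> t \<le> T} (\<lambda>(t, s). S t s y))"

text \<open>With \<open>G t = e\<^sup>A\<^sup>t\<close> the semigroup generated by \<open>A\<close>, the operator \<open>A + F(\<cdot>)\<close> generates \<open>S\<close> in
  the mild sense: $S(t,s)y = e^{A(t-s)}y + \int_s^t e^{A(t-r)} F(r) S(r,s) y\,dr$.\<close>

definition generates_evolution_operator ::
    "real \<Rightarrow> (real \<Rightarrow> 'y \<Rightarrow>\<^sub>L 'y) \<Rightarrow> (real \<Rightarrow> 'y \<Rightarrow>\<^sub>L 'y) \<Rightarrow> (real \<Rightarrow> real \<Rightarrow> 'y \<Rightarrow>\<^sub>L 'y::real_normed_vector) \<Rightarrow> bool"
  where
  "generates_evolution_operator T G F S \<longleftrightarrow>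
     evolution_operator T S \<and>
     (\<forall>s t y. 0 \<le> s \<and> s \<le> t \<and> t \<le> T \<longrightarrow>
        has_strong_bochner_integral (lebesgue_on {s<..<t})
          (\<lambda>r. G (t - r) (F r (S r s y))) (S t s y - G (t - s) y))"

text \<open>Mild solution with initial value 0: $y(t) = \int_0^t S(t,s) B(s) u(s)\,ds$.\<close>

definition mild_solution ::
    "real \<Rightarrow> (real \<Rightarrow> real \<Rightarrow> 'y \<Rightarrow>\<^sub>L 'y::real_normed_vector) \<Rightarrow> (real \<Rightarrow> 'u::real_normed_vector \<Rightarrow>\<^sub>L 'y) \<Rightarrow>
     (real \<Rightarrow> 'u) \<Rightarrow> (real \<Rightarrow> 'y) \<Rightarrow> bool" where
  "mild_solution T S B u y \<longleftrightarrow>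
     (\<forall>t\<in>{0..T}. has_strong_bochner_integral (lebesgue_on {0<..<t}) (\<lambda>s. S t s (B s (u s))) (y t))"

definition final_states ::
    "real \<Rightarrow> (real \<Rightarrow> real \<Rightarrow> 'y \<Rightarrow>\<^sub>L 'y::real_normed_vector) \<Rightarrow> (real \<Rightarrow> 'u::real_normed_vector \<Rightarrow>\<^sub>L 'y) \<Rightarrow>
     (real \<Rightarrow> 'u) set \<Rightarrow> 'y set" where
  "final_states T S B V = {y T | y u. u \<in> V \<and> mild_solution T S B u y}"

definition finite_codim_exactly_controllable ::
    "real \<Rightarrow> ereal \<Rightarrow> (real \<Rightarrow> real \<Rightarrow> 'y \<Rightarrow>\<^sub>L 'y::real_normed_vector) \<Rightarrow>
     (real \<Rightarrow> 'u::real_normed_vector \<Rightarrow>\<^sub>L 'y) \<Rightarrow> bool" where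
  "finite_codim_exactly_controllable T p S B \<longleftrightarrow>
     finite_codim_subspace (final_states T S B (Lp_space (lebesgue_on {0<..<T}) p))"

end

theory Submission
  imports Defs
begin

text \<open>The set \<open>K\<close> of final states of the controls in the unit ball of \<open>L\<^sup>p\<close> is the image of the unit
ball of a Banach space under a bounded linear operator, and the reachable set is its range \<open>span K\<close>.
Every assertion about the range can be read off from \<open>K\<close>: it is convex, balanced, and contains
the sum \<open>\<Sum>n. (1/2) ^ Suc n *\<^sub>R x n\<close> for every sequence \<open>x\<close> in \<open>K\<close>. Sets of this kind form the locale
\<open>banach_disk\<close>, and the theorem follows from two facts about them.

Suppose \<open>span K\<close> has finite codimension. Adding to \<open>K\<close> a cube in a complement yields a
disk that absorbs the whole space, hence contains a ball by the Baire category theorem and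
successive approximation. Thus \<open>span K\<close> is closed and \<open>K\<close> contains one of its balls around the origin
(\<open>span_ball_subset\<close>, \<open>closed_span\<close>). If \<open>u\<close> is interior to the closed convex hull of the
controls and \<open>y\<close> is its final state, then \<open>y + (r/2) K\<close> lies in the closed convex hull of \<open>M\<close> and is
a neighbourhood of \<open>y\<close> relative to \<open>span K\<close>; so \<open>M\<close> is finite codimensional
(\<open>finite_codim_set_of_span\<close>).

Suppose \<open>M\<close> is finite codimensional, and let \<open>L\<close> be the closed span of \<open>M - y\<close>. As the controls are
bounded, \<open>M\<close> lies in a multiple of \<open>K\<close>. Differences of points of the closed convex hull
of \<open>M - y\<close> fill a ball of \<open>L\<close> and are limits of points of \<open>L\<close> in a multiple of \<open>K\<close>. Successive
approximation removes the closure, so \<open>L\<close> is contained in \<open>span K\<close>, which then has finite codimension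
(\<open>finite_codim_span_of_set\<close>).

The analytic part consists in showing that \<open>K\<close> is a Banach disk (\<open>banach_disk_reach_disk\<close>).
It rests on the completeness of \<open>L\<^sup>p\<close> in the form \<open>Lp_dyadic_series\<close>, and on an estimate for the
Bochner integral that bounds final states by the mean of the norm of the control.\<close>

section \<open>Banach disks and subspaces of finite codimension\<close>

text \<open>A convenient notion of "image of the unit ball of a Banach space". If \<open>K\<close> is such an image under a
bounded operator, the dyadic sums converge to points of \<open>K\<close> by completeness of the domain.
Conversely these properties are all that the open mapping theorem uses about the domain, so the
operator need not be mentioned: its range is \<open>span K\<close>. Working with \<open>K\<close> alone avoids forming the
quotient of the controls by the functions that vanish almost everywhere.\<close>
locale banach_disk =
  fixes K :: "'a::banach set"
  assumes nonempty: "K \<noteq> {}"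
    and convex: "convex K"
    and balanced: "\<And>c x. \<bar>c\<bar> \<le> 1 \<Longrightarrow> x \<in> K \<Longrightarrow> c *\<^sub>R x \<in> K"
    and dyadic_sums: "\<And>x. (\<And>n. x n \<in> K) \<Longrightarrow> \<exists>y\<in>K. (\<lambda>n. (1/2) ^ Suc n *\<^sub>R x n) sums y"
begin

lemma midpoint: "x \<in> K \<Longrightarrow> y \<in> K \<Longrightarrow> (1/2) *\<^sub>R (x + y) \<in> K"
  using convexD[OF convex, of x y "1/2" "1/2"] by (simp add: scaleR_add_right)

text \<open>If points \<open>x n\<close> of norm above \<open>2 ^ Suc n\<close> existed, the terms of their dyadic sum would not tend
to zero.\<close>
lemma bounded: "\<exists>C>0. \<forall>k\<in>K. norm k \<le> C"
proof (rule ccontr)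
  assume neg: "\<not> ?thesis"
  have "\<exists>k\<in>K. norm k > 2 ^ Suc n" for n
    using neg by (metis not_le zero_less_numeral zero_less_power)
  then obtain x where x: "\<And>n. x n \<in> K" "\<And>n. norm (x n) > 2 ^ Suc n" by metis
  then obtain y where "(\<lambda>n. (1/2) ^ Suc n *\<^sub>R x n) sums y"
    using dyadic_sums[of x] by blast
  then have "(\<lambda>n. norm ((1/2) ^ Suc n *\<^sub>R x n)) \<longlonglongrightarrow> 0"
    using sums_summable summable_LIMSEQ_zero tendsto_norm_zero by blast
  then have "\<forall>\<^sub>F n in sequentially. norm ((1/2) ^ Suc n *\<^sub>R x n) < 1"
    by (rule order_tendstoD) simp
  then obtain n where n: "norm ((1/2) ^ Suc n *\<^sub>R x n) < 1"
    using eventually_happens'[OF sequentially_bot] by blast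
  have "norm ((1/2) ^ Suc n *\<^sub>R x n) = norm (x n) / 2 ^ Suc n"
    by (simp add: power_divide divide_simps del: power_Suc)
  with x(2)[of n] n show False by (simp add: divide_simps del: power_Suc split: if_splits)
qed

text \<open>The range of an operator is the union of the images of the balls of integer radius.\<close>
lemma span_eq_multiples:
  assumes y: "y \<in> span K"
  shows "\<exists>n::nat. \<exists>k\<in>K. y = real n *\<^sub>R k"
  using y
proof (induction rule: span_induct_alt)
  case base
  then show ?case using nonempty by (intro exI[of _ 0]) auto
next
  case (step c x y)
  then obtain n k where k: "k \<in> K" "y = real n *\<^sub>R k" by blast
  obtain N0 :: nat where N0: "\<bar>c\<bar> < N0" using reals_Archimedean2 by blast
  define N where "N = max (max N0 n) 1"
  have N: "\<bar>c\<bar> \<le> N" "n \<le> N" "N > 0" using N0 by (auto simp: N_def)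
  have "(c / N) *\<^sub>R x \<in> K" "(n / N) *\<^sub>R k \<in> K"
    using N step k by (auto intro!: balanced simp: divide_simps)
  then have m: "(1/2) *\<^sub>R ((c / N) *\<^sub>R x + (n / N) *\<^sub>R k) \<in> K"
    by (rule midpoint)
  have "c *\<^sub>R x + y = real (2 * N) *\<^sub>R ((1/2) *\<^sub>R ((c / N) *\<^sub>R x + (n / N) *\<^sub>R k))"
    using N by (simp add: k algebra_simps)
  with m show ?case by blast
qed

text \<open>The successive approximation step of the open mapping theorem: a point of the ball is approximated
by \<open>K\<close> up to half the radius, the doubled error lies again in the ball, and so on; the
approximants add up with dyadic weights. Approximants are taken inside \<open>L\<close> so that the errors stay
in \<open>L\<close>, on which alone the density hypothesis holds.\<close>
lemma subspace_ball_subset_double: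
  assumes L: "subspace L" and r: "r > 0"
    and cl: "\<And>x. x \<in> L \<Longrightarrow> norm x < r \<Longrightarrow> x \<in> closure (K \<inter> L)"
    and x: "x \<in> L" "norm x < r"
  shows "(1/2) *\<^sub>R x \<in> K"
proof -
  define P where "P z \<longleftrightarrow> z \<in> L \<and> norm z < r" for z
  have "\<exists>k. P z \<longrightarrow> k \<in> K \<and> P (2 *\<^sub>R (z - k))" for z
  proof (cases "P z")
    case True
    then obtain k where k: "k \<in> K \<inter> L" "dist k z < r / 2"
      using cl r unfolding P_def closure_approachable by (meson half_gt_zero)
    then have "P (2 *\<^sub>R (z - k))"
      using L True by (auto simp: P_def dist_norm norm_minus_commute intro!: subspace_scale subspace_diff)
    with k show ?thesis by blast
  qed auto
  then obtain \<kappa> where \<kappa>: "\<And>z. P z \<Longrightarrow> \<kappa> z \<in> K" "\<And>z. P z \<Longrightarrow> P (2 *\<^sub>R (z - \<kappa> z))" by metis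
  define z where "z = rec_nat x (\<lambda>_ w. 2 *\<^sub>R (w - \<kappa> w))"
  have z: "z 0 = x" "\<And>n. z (Suc n) = 2 *\<^sub>R (z n - \<kappa> (z n))" by (auto simp: z_def)
  have P: "P (z n)" for n
    by (induction n) (auto simp: z \<kappa> x P_def[of x])
  \<comment> \<open>\<open>z N\<close> is the \<open>N\<close>-th remainder, magnified by \<open>2 ^ N\<close>\<close>
  have part: "(1/2) *\<^sub>R x - (\<Sum>n<N. (1/2) ^ Suc n *\<^sub>R \<kappa> (z n)) = (1/2) ^ Suc N *\<^sub>R z N" for N
  proof (induction N)
    case (Suc N)
    have "(1/2) *\<^sub>R x - (\<Sum>n<Suc N. (1/2) ^ Suc n *\<^sub>R \<kappa> (z n))
        = (1/2) ^ Suc N *\<^sub>R z N - (1/2) ^ Suc N *\<^sub>R \<kappa> (z N)"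
      using Suc by (simp add: algebra_simps)
    also have "\<dots> = (1/2) ^ Suc (Suc N) *\<^sub>R z (Suc N)"
      by (simp add: z scaleR_diff_right)
    finally show ?case .
  qed (simp add: z)
  have "(\<lambda>N. (1/2) ^ Suc N *\<^sub>R z N) \<longlonglongrightarrow> 0"
  proof (rule Lim_null_comparison)
    show "(\<lambda>N. (1/2) ^ Suc N * r) \<longlonglongrightarrow> 0"
      by (intro tendsto_mult_left_zero LIMSEQ_Suc[OF LIMSEQ_realpow_zero]) auto
    have "norm ((1/2) ^ Suc N *\<^sub>R z N) \<le> (1/2) ^ Suc N * r" for N
      using P[of N] by (simp add: P_def)
    then show "\<forall>\<^sub>F N in sequentially. norm ((1/2) ^ Suc N *\<^sub>R z N) \<le> (1/2) ^ Suc N * r"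
      by simp
  qed
  then have "(\<lambda>N. (1/2) *\<^sub>R x - (\<Sum>n<N. (1/2) ^ Suc n *\<^sub>R \<kappa> (z n))) \<longlonglongrightarrow> 0"
    by (simp only: part)
  then have "(\<lambda>n. (1/2) ^ Suc n *\<^sub>R \<kappa> (z n)) sums ((1/2) *\<^sub>R x)"
    unfolding sums_def by (rule Lim_transform2[OF tendsto_const])
  moreover obtain y where "y \<in> K" "(\<lambda>n. (1/2) ^ Suc n *\<^sub>R \<kappa> (z n)) sums y"
    using dyadic_sums[of "\<lambda>n. \<kappa> (z n)"] \<kappa>(1)[OF P] by blast
  ultimately show ?thesis using sums_unique2 by blast
qed

text \<open>By the Baire category theorem the closure of some multiple of \<open>K\<close> has an interior point; symmetry
and convexity move it to the origin, and the previous lemma removes the closure.\<close>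
lemma contains_ball_if_absorbing:
  assumes cover: "\<And>y. \<exists>n::nat. \<exists>k\<in>K. y = real n *\<^sub>R k"
  shows "\<exists>r>0. ball 0 r \<subseteq> K"
proof -
  define Q where "Q n = closure ((\<lambda>k. real n *\<^sub>R k) ` K)" for n
  have "\<exists>n. interior (Q n) \<noteq> {}"
  proof (rule ccontr)
    assume "\<not> ?thesis"
    then have "euclidean interior_of (\<Union>(range Q)) = {}"
      by (intro Baire_category_alt) (auto simp: Q_def completely_metrizable_space_euclidean)
    moreover have "y \<in> \<Union>(range Q)" for y
    proof -
      obtain n k where "k \<in> K" "y = real n *\<^sub>R k" using cover by blast
      then have "y \<in> Q n" unfolding Q_def by (auto intro!: closure_subset[THEN subsetD])
      then show ?thesis by blast
    qed
    then have "\<Union>(range Q) = UNIV" by blast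
    ultimately show False by simp
  qed
  then obtain n x where "x \<in> interior (Q n)" by auto
  then obtain r where r: "r > 0" "ball x r \<subseteq> Q n"
    unfolding mem_interior by blast
  \<comment> \<open>the multiple \<open>0\<close> must be avoided in order to divide by it\<close>
  define m where "m = real n + 1"
  have m: "m > 0" "m \<ge> 1" "n \<le> m" by (auto simp: m_def)
  have Kn: "(\<lambda>k. real n *\<^sub>R k) ` K \<subseteq> (\<lambda>k. m *\<^sub>R k) ` K"
  proof safe
    fix k assume "k \<in> K"
    then have "(n / m) *\<^sub>R k \<in> K" using m by (intro balanced) auto
    then show "real n *\<^sub>R k \<in> (\<lambda>k. m *\<^sub>R k) ` K"
      using m by (intro image_eqI[of _ _ "(n / m) *\<^sub>R k"]) auto
  qed
  then have *: "ball x r \<subseteq> (\<lambda>k. m *\<^sub>R k) ` closure K"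
    using r closure_mono[OF Kn] by (auto simp: Q_def closure_scaleR)
  have Km: "(1/2) *\<^sub>R (a - b) \<in> closure K" if a: "a \<in> closure K" and b: "b \<in> closure K" for a b
  proof -
    obtain s where s: "\<And>i. s i \<in> K" "s \<longlonglongrightarrow> a" using a unfolding closure_sequential by blast
    obtain t where t: "\<And>i. t i \<in> K" "t \<longlonglongrightarrow> b" using b unfolding closure_sequential by blast
    have "(1/2) *\<^sub>R (s i - t i) \<in> K" for i
      using midpoint[OF s(1)[of i], of "- t i"] balanced[of "-1" "t i"] t(1)[of i]
      by simp
    moreover have "(\<lambda>i. (1/2) *\<^sub>R (s i - t i)) \<longlonglongrightarrow> (1/2) *\<^sub>R (a - b)"
      by (intro tendsto_intros s t)
    ultimately show ?thesis
      unfolding closure_sequential by (intro exI[of _ "\<lambda>i. (1/2) *\<^sub>R (s i - t i)"]) auto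
  qed
  have cl: "y \<in> closure (K \<inter> UNIV)" if "norm y < r / m" for y
  proof -
    have "x + m *\<^sub>R y \<in> ball x r" "x - m *\<^sub>R y \<in> ball x r"
      using that m by (auto simp: dist_norm field_simps)
    with * obtain a b where ab: "a \<in> closure K" "b \<in> closure K" 
      "x + m *\<^sub>R y = m *\<^sub>R a" "x - m *\<^sub>R y = m *\<^sub>R b" by blast
    have "m *\<^sub>R (a - b) = m *\<^sub>R (2 *\<^sub>R y)"
      using ab(3,4) by (simp add: algebra_simps scaleR_2)
    then have "a - b = 2 *\<^sub>R y"
      using m(1) by (metis less_numeral_extra(3) real_vector.scale_left_imp_eq)
    then have "y = (1/2) *\<^sub>R (a - b)" by simp
    then show ?thesis using Km[OF ab(1,2)] by simp
  qed
  have "ball 0 (r / m / 2) \<subseteq> K"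
  proof
    fix y :: 'a assume "y \<in> ball 0 (r / m / 2)"
    then have "norm (2 *\<^sub>R y) < r / m" by simp
    from subspace_ball_subset_double[OF subspace_UNIV _ cl UNIV_I this] show "y \<in> K"
      using r m by simp
  qed
  then show ?thesis using r m by (intro exI[of _ "r / m / 2"]) auto
qed

end

text \<open>The definition of finite codimension asks only that the complementary vectors be independent and
lie outside the subspace, which does not make the sum direct. A subset of the given
vectors that still spans and has least cardinality does.\<close>
lemma minimal_complement:
  fixes R :: "'a::real_vector set"
  assumes R: "subspace R" and Z: "finite Z" "span (R \<union> Z) = UNIV"
  obtains Z' where "Z' \<subseteq> Z" "span (R \<union> Z') = UNIV"
    "\<forall>c. (\<Sum>z\<in>Z'. c z *\<^sub>R z) \<in> R \<longrightarrow> (\<forall>z\<in>Z'. c z = 0)"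
proof -
  define P where "P W \<longleftrightarrow> W \<subseteq> Z \<and> span (R \<union> W) = UNIV" for W
  have "P Z" using Z by (simp add: P_def)
  then obtain W where W: "P W" "\<And>V. P V \<Longrightarrow> card W \<le> card V"
    using ex_has_least_nat[of P Z card] by blast
  have fW: "finite W" using W(1) Z(1) finite_subset by (auto simp: P_def)
  have "\<forall>z\<in>W. c z = 0" if c: "(\<Sum>z\<in>W. c z *\<^sub>R z) \<in> R" for c
  proof (rule ccontr)
    assume "\<not> ?thesis"
    then obtain w where w: "w \<in> W" "c w \<noteq> 0" by blast
    have "(\<Sum>z\<in>W. c z *\<^sub>R z) = c w *\<^sub>R w + (\<Sum>z\<in>W - {w}. c z *\<^sub>R z)"
      by (rule sum.remove[OF fW w(1)])
    then have "c w *\<^sub>R w = (\<Sum>z\<in>W. c z *\<^sub>R z) - (\<Sum>z\<in>W - {w}. c z *\<^sub>R z)"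
      by simp
    also have "\<dots> \<in> span (R \<union> (W - {w}))"
      using c by (intro span_diff span_sum span_scale span_base) auto
    finally have "(1 / c w) *\<^sub>R (c w *\<^sub>R w) \<in> span (R \<union> (W - {w}))"
      by (rule span_scale)
    then have "w \<in> span (R \<union> (W - {w}))" using w by simp
    then have "R \<union> W \<subseteq> span (R \<union> (W - {w}))" by (auto intro: span_base)
    then have "span (R \<union> W) \<subseteq> span (R \<union> (W - {w}))"
      using span_minimal subspace_span by blast
    then have "P (W - {w})" using W(1) by (auto simp: P_def)
    with W(2) have "card W \<le> card (W - {w})" by blast
    with w fW show False by (meson card_Diff1_less not_le)
  qed
  with W(1) show ?thesis by (intro that[of W]) (auto simp: P_def)
qed

lemma finite_codim_subspaceI:
  fixes R :: "'a::real_vector set"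
  assumes R: "subspace R" and Z: "finite Z" "span (R \<union> Z) = UNIV"
  shows "finite_codim_subspace R"
proof -
  obtain W where W: "W \<subseteq> Z" "span (R \<union> W) = UNIV"
    "\<forall>c. (\<Sum>z\<in>W. c z *\<^sub>R z) \<in> R \<longrightarrow> (\<forall>z\<in>W. c z = 0)"
    by (rule minimal_complement[OF assms])
  have fW: "finite W" using W(1) Z(1) finite_subset by auto
  have "independent W"
    using W(3) subspace_0[OF R] by (auto simp: dependent_finite[OF fW])
  moreover have "W \<inter> R = {}"
  proof (rule ccontr)
    assume "W \<inter> R \<noteq> {}"
    then obtain w where w: "w \<in> W" "w \<in> R" by blast
    have "(\<Sum>z\<in>W. (if z = w then 1 else 0) *\<^sub>R z) = (\<Sum>z\<in>W. if z = w then z else 0)"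
      by (intro sum.cong) auto
    also have "\<dots> = w" using fW w by simp
    finally show False using W(3)[THEN spec[of _ "\<lambda>z. if z = w then 1 else 0"]] w by auto
  qed
  ultimately show ?thesis
    using R fW W(2) unfolding finite_codim_subspace_def by blast
qed

lemma finite_codim_subspace_mono:
  assumes "finite_codim_subspace L" "L \<subseteq> R" "subspace R"
  shows "finite_codim_subspace R"
proof -
  obtain Z where Z: "finite Z" "span (L \<union> Z) = UNIV"
    using assms(1) unfolding finite_codim_subspace_def by blast
  have "span (L \<union> Z) \<subseteq> span (R \<union> Z)" using assms(2) by (intro span_mono) auto
  with Z assms(3) show ?thesis by (intro finite_codim_subspaceI[of R Z]) auto
qed

lemma subspace_closure:
  fixes L :: "'a::real_normed_vector set"
  assumes L: "subspace L"
  shows "subspace (closure L)"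
proof (rule subspaceI)
  show "0 \<in> closure L" using subspace_0[OF L] closure_subset by blast
next
  fix x y assume "x \<in> closure L" "y \<in> closure L"
  then obtain f g where f: "\<forall>n. f n \<in> L" "f \<longlonglongrightarrow> x" and g: "\<forall>n. g n \<in> L" "g \<longlonglongrightarrow> y"
    unfolding closure_sequential by blast
  then show "x + y \<in> closure L"
    unfolding closure_sequential using subspace_add[OF L]
    by (intro exI[of _ "\<lambda>n. f n + g n"]) (auto intro: tendsto_add)
next
  fix c x assume "x \<in> closure L"
  then obtain f where f: "\<forall>n. f n \<in> L" "f \<longlonglongrightarrow> x"
    unfolding closure_sequential by blast
  then show "c *\<^sub>R x \<in> closure L"
    unfolding closure_sequential using subspace_scale[OF L]
    by (intro exI[of _ "\<lambda>n. c *\<^sub>R f n"]) (auto intro: tendsto_scaleR)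
qed

context banach_disk
begin

text \<open>Enlarging the disk by a cube in a complement of finite dimension makes a finite codimensional range
into the whole space.\<close>
definition cube_sum :: "'a set \<Rightarrow> 'a set" where
  "cube_sum Z = {k + (\<Sum>z\<in>Z. c z *\<^sub>R z) | k c. k \<in> K \<and> (\<forall>z\<in>Z. \<bar>c z\<bar> \<le> 1)}"

lemma cube_sumI:
  "k \<in> K \<Longrightarrow> (\<And>z. z \<in> Z \<Longrightarrow> \<bar>c z\<bar> \<le> 1) \<Longrightarrow> k + (\<Sum>z\<in>Z. c z *\<^sub>R z) \<in> cube_sum Z"
  unfolding cube_sum_def by blast

lemma cube_sumE:
  assumes "x \<in> cube_sum Z"
  obtains k c where "x = k + (\<Sum>z\<in>Z. c z *\<^sub>R z)" "k \<in> K" "\<forall>z\<in>Z. \<bar>c z\<bar> \<le> 1"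
  using assms unfolding cube_sum_def by blast

lemma banach_disk_cube_sum: "banach_disk (cube_sum Z)"
proof
  obtain k where "k \<in> K" using nonempty by blast
  from cube_sumI[OF this, of Z "\<lambda>_. 0"] show "cube_sum Z \<noteq> {}" by auto
next
  show "convex (cube_sum Z)"
  proof (rule convexI)
    fix x y and a b :: real
    assume x: "x \<in> cube_sum Z" and y: "y \<in> cube_sum Z" and ab: "0 \<le> a" "0 \<le> b" "a + b = 1"
    obtain k c where k: "x = k + (\<Sum>z\<in>Z. c z *\<^sub>R z)" "k \<in> K" "\<forall>z\<in>Z. \<bar>c z\<bar> \<le> 1"
      using x by (rule cube_sumE)
    obtain l d where l: "y = l + (\<Sum>z\<in>Z. d z *\<^sub>R z)" "l \<in> K" "\<forall>z\<in>Z. \<bar>d z\<bar> \<le> 1"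
      using y by (rule cube_sumE)
    have "a *\<^sub>R k + b *\<^sub>R l \<in> K" by (rule convexD[OF convex k(2) l(2) ab])
    moreover have "\<bar>a * c z + b * d z\<bar> \<le> 1" if "z \<in> Z" for z
    proof -
      have "\<bar>a * c z + b * d z\<bar> \<le> a * \<bar>c z\<bar> + b * \<bar>d z\<bar>"
        using ab abs_triangle_ineq[of "a * c z" "b * d z"] by (simp add: abs_mult)
      also have "\<dots> \<le> a * 1 + b * 1"
        using k(3) l(3) that ab by (intro add_mono mult_left_mono) auto
      finally show ?thesis using ab by simp
    qed
    ultimately have "(a *\<^sub>R k + b *\<^sub>R l) + (\<Sum>z\<in>Z. (a * c z + b * d z) *\<^sub>R z) \<in> cube_sum Z"
      by (rule cube_sumI)
    then show "a *\<^sub>R x + b *\<^sub>R y \<in> cube_sum Z"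
      by (simp add: k l algebra_simps sum.distrib scaleR_sum_right)
  qed
next
  fix a x assume a: "\<bar>a\<bar> \<le> (1::real)" and "x \<in> cube_sum Z"
  from this(2) obtain k c where x: "x = k + (\<Sum>z\<in>Z. c z *\<^sub>R z)" "k \<in> K" "\<forall>z\<in>Z. \<bar>c z\<bar> \<le> 1"
    by (rule cube_sumE)
  have "a *\<^sub>R x = a *\<^sub>R k + (\<Sum>z\<in>Z. (a * c z) *\<^sub>R z)"
    by (simp add: x scaleR_add_right scaleR_sum_right)
  also have "\<dots> \<in> cube_sum Z"
    using x(3) a by (intro cube_sumI balanced x(2)) (auto simp: abs_mult mult_le_one)
  finally show "a *\<^sub>R x \<in> cube_sum Z" .
next
  fix x :: "nat \<Rightarrow> 'a" assume "\<And>n. x n \<in> cube_sum Z"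
  then have "\<forall>n. \<exists>k c. x n = k + (\<Sum>z\<in>Z. c z *\<^sub>R z) \<and> k \<in> K \<and> (\<forall>z\<in>Z. \<bar>c z\<bar> \<le> 1)"
    unfolding cube_sum_def by auto
  then obtain k c where x: "\<And>n. x n = k n + (\<Sum>z\<in>Z. c n z *\<^sub>R z)"
    and k: "\<And>n. k n \<in> K" and c: "\<And>n z. z \<in> Z \<Longrightarrow> \<bar>c n z\<bar> \<le> 1"
    by metis
  obtain l where l: "l \<in> K" "(\<lambda>n. (1/2) ^ Suc n *\<^sub>R k n) sums l"
    using dyadic_sums[of k] k by blast
  define d where "d z = (\<Sum>n. (1/2) ^ Suc n * c n z)" for z
  have d: "(\<lambda>n. (1/2) ^ Suc n * c n z) sums d z" "\<bar>d z\<bar> \<le> 1" if "z \<in> Z" for z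
  proof -
    have le: "norm ((1/2) ^ Suc n * c n z) \<le> (1/2) ^ Suc n" for n
      using c[OF that, of n] by (simp add: abs_mult mult_le_one)
    have S: "summable (\<lambda>n. (1/2) ^ Suc n * c n z)"
      by (rule summable_comparison_test'[OF sums_summable[OF power_half_series] le])
    then show "(\<lambda>n. (1/2) ^ Suc n * c n z) sums d z" by (simp add: d_def summable_sums)
    have "norm (d z) \<le> (\<Sum>n. (1/2) ^ Suc n)"
      unfolding d_def
      by (rule norm_suminf_le[OF le sums_summable[OF power_half_series]])
    then show "\<bar>d z\<bar> \<le> 1" using sums_unique[OF power_half_series] by simp
  qed
  have "(\<lambda>n. (1/2) ^ Suc n *\<^sub>R k n + (\<Sum>z\<in>Z. ((1/2) ^ Suc n * c n z) *\<^sub>R z))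
          sums (l + (\<Sum>z\<in>Z. d z *\<^sub>R z))"
    by (intro sums_add l sums_sum sums_scaleR_left d)
  moreover have "(1/2) ^ Suc n *\<^sub>R k n + (\<Sum>z\<in>Z. ((1/2) ^ Suc n * c n z) *\<^sub>R z)
      = (1/2) ^ Suc n *\<^sub>R x n" for n
    by (simp add: x scaleR_add_right scaleR_sum_right del: power_Suc)
  ultimately have "(\<lambda>n. (1/2) ^ Suc n *\<^sub>R x n) sums (l + (\<Sum>z\<in>Z. d z *\<^sub>R z))"
    by (simp only:)
  moreover have "l + (\<Sum>z\<in>Z. d z *\<^sub>R z) \<in> cube_sum Z" using l d by (intro cube_sumI)
  ultimately show "\<exists>y\<in>cube_sum Z. (\<lambda>n. (1/2) ^ Suc n *\<^sub>R x n) sums y" by blast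
qed

text \<open>The range of an operator of finite codimension is closed, and the operator is open onto it. The
disk \<open>cube_sum Z\<close> absorbs the whole space, hence contains a ball of radius \<open>r\<close>; a point
of \<open>span K\<close> in this ball has no component along \<open>Z\<close>, since the sum is direct, and therefore lies
in \<open>K\<close>.\<close>
lemma
  assumes R: "finite_codim_subspace (span K)"
  shows span_ball_subset: "\<exists>r>0. span K \<inter> ball 0 r \<subseteq> K" and closed_span: "closed (span K)"
proof -
  define R where "R = span K"
  have sR: "subspace R" by (simp add: R_def)
  obtain Z0 where Z0: "finite Z0" "span (R \<union> Z0) = UNIV"
    using R unfolding finite_codim_subspace_def R_def by blast
  obtain Z where "Z \<subseteq> Z0" and Z: "span (R \<union> Z) = UNIV"
    and "\<forall>c. (\<Sum>z\<in>Z. c z *\<^sub>R z) \<in> R \<longrightarrow> (\<forall>z\<in>Z. c z = 0)"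
    by (rule minimal_complement[OF sR Z0])
  then have fZ: "finite Z" 
    and unique: "\<And>c z. (\<Sum>z\<in>Z. c z *\<^sub>R z) \<in> R \<Longrightarrow> z \<in> Z \<Longrightarrow> c z = 0"
    using Z0(1) by (auto intro: finite_subset)
  have decomp: "\<exists>y\<in>R. \<exists>c. x = y + (\<Sum>z\<in>Z. c z *\<^sub>R z)" for x
  proof -
    have "x \<in> span (R \<union> Z)" using Z by simp
    then obtain a b where ab: "a \<in> span R" "b \<in> span Z" "x = a + b"
      unfolding span_Un by blast
    from ab(2) obtain c where "b = (\<Sum>z\<in>Z. c z *\<^sub>R z)"
      unfolding span_finite[OF fZ] by blast
    moreover have "a \<in> R" using ab(1) span_eq_iff[THEN iffD2, OF sR] by (simp only:)
    ultimately show ?thesis using ab(3) by blast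
  qed
  have "\<exists>n::nat. \<exists>q\<in>cube_sum Z. x = real n *\<^sub>R q" for x
  proof -
    obtain y c where y: "y \<in> R" "x = y + (\<Sum>z\<in>Z. c z *\<^sub>R z)" using decomp by blast
    obtain n k where k: "k \<in> K" "y = real n *\<^sub>R k"
      using span_eq_multiples y(1) unfolding R_def by blast
    obtain N0 :: nat where N0: "(\<Sum>z\<in>Z. \<bar>c z\<bar>) < N0" using reals_Archimedean2 by blast
    define N where "N = max (max N0 n) 1"
    have N: "(\<Sum>z\<in>Z. \<bar>c z\<bar>) \<le> N" "n \<le> N" "N > 0" using N0 by (auto simp: N_def)
    have "\<bar>c z\<bar> \<le> N" if "z \<in> Z" for z
      using member_le_sum[OF that, of "\<lambda>z. \<bar>c z\<bar>"] fZ N(1) by simp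
    then have cN: "\<forall>z\<in>Z. \<bar>c z / N\<bar> \<le> 1" using N by (simp add: divide_simps)
    have "(n / N) *\<^sub>R k \<in> K"
      using N k by (auto intro!: balanced simp: divide_simps)
    then have q: "(n / N) *\<^sub>R k + (\<Sum>z\<in>Z. (c z / N) *\<^sub>R z) \<in> cube_sum Z"
      using cN by (intro cube_sumI) auto
    have "x = real N *\<^sub>R ((n / N) *\<^sub>R k + (\<Sum>z\<in>Z. (c z / N) *\<^sub>R z))"
      using N by (simp add: y k scaleR_add_right scaleR_sum_right)
    with q show ?thesis by blast
  qed
  then obtain r where r: "r > 0" "ball 0 r \<subseteq> cube_sum Z"
    using banach_disk.contains_ball_if_absorbing[OF banach_disk_cube_sum] by blast
  have KR: "K \<subseteq> R" by (auto simp: R_def span_base)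
  have "R \<inter> ball 0 r \<subseteq> K"
  proof
    fix y assume y: "y \<in> R \<inter> ball 0 r"
    then have "y \<in> cube_sum Z" using r by blast
    then obtain k c where k: "y = k + (\<Sum>z\<in>Z. c z *\<^sub>R z)" "k \<in> K" by (rule cube_sumE)
    then have "(\<Sum>z\<in>Z. c z *\<^sub>R z) = y - k" by simp
    also have "\<dots> \<in> R" using y k KR by (intro subspace_diff[OF sR]) auto
    finally have "c z = 0" if "z \<in> Z" for z using unique that by blast
    with k show "y \<in> K" by simp
  qed
  with r show "\<exists>r>0. span K \<inter> ball 0 r \<subseteq> K" unfolding R_def by blast
  \<comment> \<open>A point of the closure has component \<open>0\<close> in the complement: all its multiples lie
    within \<open>r\<close> of \<open>R\<close>, whereas the cube bounds the component of any point of the \<open>r\<close>-ball.\<close>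
  have "closure R \<subseteq> R"
  proof
    fix x assume x: "x \<in> closure R"
    obtain y c where y: "y \<in> R" "x = y + (\<Sum>z\<in>Z. c z *\<^sub>R z)" using decomp by blast
    have "\<bar>c z\<bar> * n \<le> 1" if z: "z \<in> Z" for z and n :: nat
    proof -
      have "real n *\<^sub>R x \<in> closure R"
        using x sR by (intro subspace_scale[OF subspace_closure])
      then obtain v where v: "v \<in> R" "dist v (real n *\<^sub>R x) < r"
        using r(1) closure_approachable by blast
      have "real n *\<^sub>R x - v \<in> cube_sum Z"
        using v(2) r(2) by (auto simp: dist_norm norm_minus_commute)
      then obtain k d where k: "real n *\<^sub>R x - v = k + (\<Sum>z\<in>Z. d z *\<^sub>R z)" "k \<in> K"
        "\<forall>z\<in>Z. \<bar>d z\<bar> \<le> 1" by (rule cube_sumE)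
      have "(\<Sum>z\<in>Z. (n * c z - d z) *\<^sub>R z)
          = real n *\<^sub>R (\<Sum>z\<in>Z. c z *\<^sub>R z) - (\<Sum>z\<in>Z. d z *\<^sub>R z)"
        by (simp add: scaleR_diff_left sum_subtractf scaleR_sum_right)
      also have "\<dots> = k + v - real n *\<^sub>R y"
        using k(1) y(2) by (simp add: algebra_simps)
      also have "\<dots> \<in> R"
        using k(2) KR v(1) y(1) by (intro subspace_diff[OF sR] subspace_add[OF sR] subspace_scale[OF sR]) auto
      finally have "n * c z - d z = 0" using unique[of "\<lambda>z. n * c z - d z"] z by simp
      then have "\<bar>n * c z\<bar> = \<bar>d z\<bar>" by simp
      with k(3) z show ?thesis by (simp add: abs_mult mult.commute)
    qed
    have "c z = 0" if "z \<in> Z" for z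
    proof (rule ccontr)
      assume "c z \<noteq> 0"
      then obtain n :: nat where "1 < n * \<bar>c z\<bar>" using ex_less_of_nat_mult[of "\<bar>c z\<bar>" 1] by auto
      with \<open>\<And>z n. z \<in> Z \<Longrightarrow> \<bar>c z\<bar> * real n \<le> 1\<close>[OF that, of n] show False
        by (simp add: mult.commute)
    qed
    then show "x \<in> R" using y by simp
  qed
  then show "closed (span K)" unfolding R_def by (simp only: closure_subset_eq)
qed

text \<open>Differences of points of a set with relative interior in \<open>L\<close> fill a ball of \<open>L\<close>. They are limits
of differences of convex combinations of \<open>D\<close>, and these lie in \<open>L\<close> and in a multiple of \<open>K\<close>;
successive approximation within \<open>L\<close> then gives \<open>L \<subseteq> span K\<close>.\<close>
lemma finite_codim_span_of_set:
  assumes D: "\<And>x. x \<in> D \<Longrightarrow> \<exists>k\<in>K. x = c *\<^sub>R k" and fin: "finite_codim_set D"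
  shows "finite_codim_subspace (span K)"
proof -
  obtain y where y: "finite_codim_subspace (closure (span ((\<lambda>x. x - y) ` D)))"
    "(top_of_set (closure (span ((\<lambda>x. x - y) ` D)))) interior_of
       (closure (convex hull ((\<lambda>x. x - y) ` D))) \<noteq> {}"
    using fin unfolding finite_codim_set_def Let_def by blast
  define L where "L = closure (span ((\<lambda>x. x - y) ` D))"
  define V where "V = convex hull ((\<lambda>x. x - y) ` D)"
  have L: "subspace L" unfolding L_def by (simp add: subspace_closure)
  have VL: "V \<subseteq> L"
    unfolding V_def L_def using convex_hull_subset_span closure_subset by blast
  obtain w r where r: "r > 0" and w: "w \<in> L" "\<And>x. x \<in> L \<Longrightarrow> dist w x < r \<Longrightarrow> x \<in> closure V"
  proof -
    obtain T w where T: "openin (top_of_set L) T" "w \<in> T" "T \<subseteq> closure V"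
      using y(2) unfolding L_def[symmetric] V_def[symmetric] interior_of_def by blast
    then obtain r where "r > 0" "ball w r \<inter> L \<subseteq> T" "w \<in> L"
      unfolding openin_contains_ball by blast
    with T show ?thesis by (intro that[of r w]) auto
  qed
  \<comment> \<open>The factor \<open>2\<close> comes from passing to differences; the summand \<open>1\<close> keeps \<open>s\<close> positive when \<open>c = 0\<close>.\<close>
  define s where "s = 2 * \<bar>c\<bar> + 1"
  have s: "s > 0" by (simp add: s_def)
  have DK: "convex hull D \<subseteq> (\<lambda>k. c *\<^sub>R k) ` K"
    using D by (intro hull_minimal convex_scaling convex) auto
  have diff: "(1/s) *\<^sub>R (a - b) \<in> K \<inter> L" if a: "a \<in> V" and b: "b \<in> V" for a b
  proof -
    have "V = (\<lambda>x. x - y) ` (convex hull D)"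
      using convex_hull_translation[of "-y" D] by (simp add: V_def)
    then obtain k l where k: "k \<in> K" "a = c *\<^sub>R k - y" and l: "l \<in> K" "b = c *\<^sub>R l - y"
      using a b DK by blast
    have "\<bar>2 * c / s\<bar> \<le> 1" "- l \<in> K"
      using balanced[of "-1" l] l s by (auto simp: s_def divide_simps)
    then have "(2 * c / s) *\<^sub>R ((1/2) *\<^sub>R (k + - l)) \<in> K"
      using k by (intro balanced midpoint)
    also have "(2 * c / s) *\<^sub>R ((1/2) *\<^sub>R (k + - l)) = (1/s) *\<^sub>R (a - b)"
      by (simp add: k l algebra_simps)
    finally show ?thesis using a b VL L by (auto intro!: subspace_scale subspace_diff)
  qed
  have "x \<in> span K" if x: "x \<in> L" for x
  proof -
    have cl: "z \<in> closure (K \<inter> L)" if z: "z \<in> L" "norm z < r / s" for z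
    proof -
      have "w + s *\<^sub>R z \<in> closure V"
        using z w(1) s L by (intro w(2)) (auto simp: dist_norm field_simps intro: subspace_add subspace_scale)
      moreover have "w \<in> closure V" using w r by auto
      ultimately obtain f g where f: "\<And>i. f i \<in> V" "f \<longlonglongrightarrow> w + s *\<^sub>R z" 
        and g: "\<And>i. g i \<in> V" "g \<longlonglongrightarrow> w"
        unfolding closure_sequential by blast
      have "(\<lambda>i. (1/s) *\<^sub>R (f i - g i)) \<longlonglongrightarrow> (1/s) *\<^sub>R (w + s *\<^sub>R z - w)"
        by (intro tendsto_intros f g)
      then show ?thesis
        using diff[OF f(1) g(1)] s unfolding closure_sequential
        by (intro exI[of _ "\<lambda>i. (1/s) *\<^sub>R (f i - g i)"]) auto
    qed
    \<comment> \<open>scales \<open>x\<close> into the ball of radius \<open>r / s\<close>, also when \<open>x = 0\<close>\<close>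
    define t where "t = r / s / (norm x + 1)"
    have t: "t > 0" using r s by (simp add: t_def add_nonneg_pos)
    have "t * norm x < t * (norm x + 1)" using t by simp
    also have "\<dots> = r / s" using add_nonneg_pos[of "norm x" 1] by (simp add: t_def)
    finally have "norm (t *\<^sub>R x) < r / s" using t by simp
    from subspace_ball_subset_double[OF L _ cl _ this]
    have "(1/2) *\<^sub>R (t *\<^sub>R x) \<in> K" using r s x L by (simp add: subspace_scale)
    then have "(2 / t) *\<^sub>R ((1/2) *\<^sub>R (t *\<^sub>R x)) \<in> span K" by (intro span_scale span_base)
    then show ?thesis using t by simp
  qed
  then have "L \<subseteq> span K" by blast
  moreover have "finite_codim_subspace L" using y(1) by (simp only: L_def)
  ultimately show ?thesis by (intro finite_codim_subspace_mono[OF _ _ subspace_span])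
qed

text \<open>Openness onto the closed range turns \<open>y + e K\<close> into a relative neighbourhood of \<open>y\<close> in
\<open>span K\<close>. This neighbourhood also forces the closed span of \<open>D - y\<close> to be all of \<open>span K\<close>.\<close>
lemma finite_codim_set_of_span:
  assumes fin: "finite_codim_subspace (span K)" and D: "D \<subseteq> span K"
    and y: "y \<in> span K" "y \<in> closure (convex hull D)"
    and e: "e > 0" "\<And>k. k \<in> K \<Longrightarrow> y + e *\<^sub>R k \<in> closure (convex hull D)"
  shows "finite_codim_set D"
proof -
  obtain r where r: "r > 0" "span K \<inter> ball 0 r \<subseteq> K" using span_ball_subset[OF fin] by blast
  define D' where "D' = (\<lambda>x. x - y) ` D"
  have hull: "closure (convex hull D') = (\<lambda>x. x - y) ` closure (convex hull D)"
    using convex_hull_translation[of "-y" D] closure_translation[of "-y" "convex hull D"]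
    by (simp add: D'_def)
  have ball: "x \<in> closure (convex hull D')" if x: "x \<in> span K" "norm x < e * r" for x
  proof -
    have "(1/e) *\<^sub>R x \<in> K" using x e r by (intro subsetD[OF r(2)]) (auto simp: span_scale field_simps)
    from e(2)[OF this] have "y + x \<in> closure (convex hull D)" using e by simp
    then show ?thesis unfolding hull by force
  qed
  have D'R: "D' \<subseteq> span K" using D y by (auto simp: D'_def intro: span_diff)
  have "closure (span D') \<subseteq> span K"
    using closed_span[OF fin] D'R by (intro closure_minimal span_minimal) auto
  moreover have "span K \<subseteq> closure (span D')"
  proof
    fix x assume x: "x \<in> span K"
    define t where "t = e * r / (norm x + 1)"
    have t: "t > 0" using r e by (simp add: t_def add_nonneg_pos)
    have "t * norm x < t * (norm x + 1)" using t by simp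
    also have "\<dots> = e * r" using add_nonneg_pos[of "norm x" 1] by (simp add: t_def)
    finally have "t *\<^sub>R x \<in> closure (convex hull D')" using t x by (intro ball) (auto simp: span_scale)
    then have "t *\<^sub>R x \<in> closure (span D')"
      using closure_mono[OF convex_hull_subset_span] by blast
    then have "(1/t) *\<^sub>R (t *\<^sub>R x) \<in> closure (span D')"
      by (rule subspace_scale[OF subspace_closure[OF subspace_span]])
    then show "x \<in> closure (span D')" using t by simp
  qed
  ultimately have L: "closure (span D') = span K" by blast
  have "span K \<inter> ball 0 (e * r) \<subseteq> (top_of_set (span K)) interior_of (closure (convex hull D'))"
    using ball by (intro interior_of_maximal) auto
  moreover have "0 \<in> span K \<inter> ball 0 (e * r)" using e r by (simp add: span_zero)
  ultimately show ?thesis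
    unfolding finite_codim_set_def Let_def
    using fin y(2) L unfolding D'_def by (intro bexI[of _ y]) auto
qed

end

section \<open>Strongly measurable functions and their integral\<close>
lemma (in complete_measure) borel_measurable_AE_cong:
  assumes g: "g \<in> borel_measurable M" and eq: "AE x in M. f x = g x"
  shows "f \<in> borel_measurable M"
proof (rule measurableI)
  fix A :: "'b set" assume A: "A \<in> sets borel"
  show "f -` A \<inter> space M \<in> sets M"
  proof (rule in_sets_AE)
    show "AE x in M. x \<in> g -` A \<inter> space M \<longleftrightarrow> x \<in> f -` A \<inter> space M"
      using eq by eventually_elim auto
    show "g -` A \<inter> space M \<in> sets M" by (rule measurable_sets[OF g A])
  qed auto
qed simp

lemma (in complete_measure) borel_measurable_AE_LIMSEQ:
  fixes f :: "nat \<Rightarrow> 'a \<Rightarrow> real"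
  assumes "\<And>i. f i \<in> borel_measurable M" and "AE x in M. (\<lambda>i. f i x) \<longlonglongrightarrow> g x"
  shows "g \<in> borel_measurable M"
proof (rule borel_measurable_AE_cong)
  show "(\<lambda>x. lim (\<lambda>i. f i x)) \<in> borel_measurable M"
    using assms(1) by measurable
  show "AE x in M. g x = lim (\<lambda>i. f i x)"
    using assms(2) by eventually_elim (simp add: limI)
qed

lemma complete_measure_restrict_space:
  assumes M: "complete_measure M" and A: "A \<in> sets M"
  shows "complete_measure (restrict_space M A)"
proof
  fix N B assume "B \<subseteq> N" "N \<in> null_sets (restrict_space M A)"
  then have "N \<in> null_sets M" "N \<subseteq> A"
    using A by (auto simp: null_sets_restrict_space)
  then have "B \<in> sets M" "B \<subseteq> A" using \<open>B \<subseteq> N\<close> complete_measure.complete[OF M] by auto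
  then show "B \<in> sets (restrict_space M A)" using A by (auto simp: sets_restrict_space_iff)
qed

lemma strongly_measurable_compose2:
  assumes f: "strongly_measurable M f" and g: "strongly_measurable M g"
    and h: "\<And>s t a b. s \<longlonglongrightarrow> a \<Longrightarrow> t \<longlonglongrightarrow> b \<Longrightarrow> (\<lambda>i. h (s i) (t i)) \<longlonglongrightarrow> h a b"
  shows "strongly_measurable M (\<lambda>x. h (f x) (g x))"
proof -
  obtain s where s: "\<And>i. simple_function M (s i)" "AE x in M. (\<lambda>i. s i x) \<longlonglongrightarrow> f x"
    using f unfolding strongly_measurable_def by blast
  obtain t where t: "\<And>i. simple_function M (t i)" "AE x in M. (\<lambda>i. t i x) \<longlonglongrightarrow> g x"
    using g unfolding strongly_measurable_def by blast
  have "AE x in M. (\<lambda>i. h (s i x) (t i x)) \<longlonglongrightarrow> h (f x) (g x)"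
    using s(2) t(2) by eventually_elim (rule h)
  moreover have "simple_function M (\<lambda>x. h (s i x) (t i x))" for i
    by (rule simple_function_compose2[OF s(1) t(1)])
  ultimately show ?thesis
    unfolding strongly_measurable_def by (intro exI[of _ "\<lambda>i x. h (s i x) (t i x)"]) simp
qed

lemma strongly_measurable_const: "strongly_measurable M (\<lambda>x. c)"
  unfolding strongly_measurable_def by (intro exI[of _ "\<lambda>_ _. c"]) auto

lemma strongly_measurable_add:
  "strongly_measurable M f \<Longrightarrow> strongly_measurable M g \<Longrightarrow> strongly_measurable M (\<lambda>x. f x + g x)"
  by (rule strongly_measurable_compose2[where h = "(+)"]) (auto intro: tendsto_add)

lemma strongly_measurable_scaleR:
  assumes "strongly_measurable M f"
  shows "strongly_measurable M (\<lambda>x. c *\<^sub>R f x)"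
  by (rule strongly_measurable_compose2[OF assms assms, where h = "\<lambda>x y. c *\<^sub>R x"])
     (auto intro: tendsto_scaleR)

lemma strongly_measurable_simple:
  "simple_function M s \<Longrightarrow> strongly_measurable M s"
  unfolding strongly_measurable_def by (intro exI[of _ "\<lambda>_. s"]) auto

lemma strongly_measurable_diff:
  "strongly_measurable M f \<Longrightarrow> strongly_measurable M g \<Longrightarrow> strongly_measurable M (\<lambda>x. f x - g x)"
  by (rule strongly_measurable_compose2[where h = "(-)"]) (auto intro: tendsto_diff)

lemma strongly_measurable_restrict_space:
  fixes f :: "'a \<Rightarrow> 'b::real_normed_vector"
  assumes f: "strongly_measurable M f" and A: "A \<in> sets M"
  shows "strongly_measurable (restrict_space M A) f"
proof -
  obtain s where s: "\<And>i. simple_function M (s i)" "AE x in M. (\<lambda>i. s i x) \<longlonglongrightarrow> f x"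
    using f unfolding strongly_measurable_def by blast
  have A': "A \<inter> space M \<in> sets M" using A by simp
  have "simple_function M (\<lambda>x. indicator A x *\<^sub>R s i x)" for i
    using simple_function_compose2[OF simple_function_indicator[OF A, where 'b=real] s(1)[of i], of "(*\<^sub>R)"] .
  then have "simple_function (restrict_space M A) (s i)" for i
    by (simp add: simple_function_restrict_space[OF A'])
  moreover have "AE x in restrict_space M A. (\<lambda>i. s i x) \<longlonglongrightarrow> f x"
    unfolding AE_restrict_space_iff[OF A'] using s(2) by eventually_elim simp
  ultimately show ?thesis unfolding strongly_measurable_def by blast
qed

lemma (in complete_measure) strongly_measurable_norm:
  assumes "strongly_measurable M f"
  shows "(\<lambda>x. norm (f x)) \<in> borel_measurable M"
proof -
  obtain s where s: "\<And>i. simple_function M (s i)" "AE x in M. (\<lambda>i. s i x) \<longlonglongrightarrow> f x"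
    using assms unfolding strongly_measurable_def by blast
  show ?thesis
  proof (rule borel_measurable_AE_LIMSEQ)
    show "(\<lambda>x. norm (s i x)) \<in> borel_measurable M" for i
      by (rule borel_measurable_simple_function[OF simple_function_compose1[OF s(1)]])
    show "AE x in M. (\<lambda>i. norm (s i x)) \<longlonglongrightarrow> norm (f x)"
      using s(2) by eventually_elim (rule tendsto_norm)
  qed
qed

lemma ennreal_LIMSEQ_zero_mono:
  fixes f g :: "nat \<Rightarrow> ennreal"
  assumes "\<And>i. f i \<le> g i" "g \<longlonglongrightarrow> 0"
  shows "f \<longlonglongrightarrow> 0"
  by (rule tendsto_sandwich[where f = "\<lambda>_. 0" and h = g]) (use assms in simp_all)

lemma norm_simple_bochner_integral_le:
  assumes s: "Bochner_Integration.simple_bochner_integrable M s"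
  shows "ennreal (norm (Bochner_Integration.simple_bochner_integral M s)) \<le> (\<integral>\<^sup>+x. norm (s x) \<partial>M)"
proof -
  have "ennreal (norm (Bochner_Integration.simple_bochner_integral M s))
      \<le> ennreal (Bochner_Integration.simple_bochner_integral M (\<lambda>x. norm (s x)))"
    by (intro ennreal_leI Bochner_Integration.simple_bochner_integral_norm_bound s)
  also have "\<dots> = (\<integral>\<^sup>+x. norm (s x) \<partial>M)"
    using Bochner_Integration.simple_bochner_integrable_compose2[of "\<lambda>x y. norm x" M s s] s
    by (intro Bochner_Integration.simple_bochner_integral_eq_nn_integral) auto
  finally show ?thesis .
qed

text \<open>On a complete measure space the norm of a strongly measurable function is measurable, being an
almost everywhere limit of simple functions; this is what makes the lower integrals in the
definition of the Bochner integral additive. On a finite measure space every simple function is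
integrable.\<close>
locale finite_complete_measure = finite_measure M + complete_measure M for M :: "'a measure"
begin

lemma simple_bochner_integrable_simple:
  "Bochner_Integration.simple_bochner_integrable M s \<longleftrightarrow> simple_function M s"
  using emeasure_finite by (auto simp: Bochner_Integration.simple_bochner_integrable.simps)

lemma nn_integral_norm_triangle:
  assumes "strongly_measurable M f" "strongly_measurable M g"
    and "\<And>x. norm (h x) \<le> norm (f x) + norm (g x)"
  shows "(\<integral>\<^sup>+x. norm (h x) \<partial>M) \<le> (\<integral>\<^sup>+x. norm (f x) \<partial>M) + (\<integral>\<^sup>+x. norm (g x) \<partial>M)"
proof -
  have "(\<integral>\<^sup>+x. norm (h x) \<partial>M) \<le> (\<integral>\<^sup>+x. ennreal (norm (f x)) + ennreal (norm (g x)) \<partial>M)"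
    using assms(3) by (intro nn_integral_mono) (simp flip: ennreal_plus)
  also have "\<dots> = (\<integral>\<^sup>+x. norm (f x) \<partial>M) + (\<integral>\<^sup>+x. norm (g x) \<partial>M)"
    using assms(1,2) by (intro nn_integral_add) (auto intro!: measurable_compose[OF strongly_measurable_norm])
  finally show ?thesis .
qed

lemma nn_integral_norm_scaleR:
  assumes "strongly_measurable M f"
  shows "(\<integral>\<^sup>+x. norm (c *\<^sub>R f x) \<partial>M) = ennreal \<bar>c\<bar> * (\<integral>\<^sup>+x. norm (f x) \<partial>M)"
proof -
  have [measurable]: "(\<lambda>x. norm (f x)) \<in> borel_measurable M" by (rule strongly_measurable_norm[OF assms])
  show ?thesis by (simp add: ennreal_mult nn_integral_cmult)
qed

text \<open>Together with linearity this estimate yields uniqueness of the integral, as well as the continuity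
of the integral in the integrand.\<close>
lemma norm_integral_le:
  assumes f: "has_strong_bochner_integral M f x"
  shows "ennreal (norm x) \<le> (\<integral>\<^sup>+t. norm (f t) \<partial>M)"
proof -
  obtain s where m: "strongly_measurable M f"
    and s: "\<And>i. Bochner_Integration.simple_bochner_integrable M (s i)"
      "(\<lambda>i. \<integral>\<^sup>+ t. norm (f t - s i t) \<partial>M) \<longlonglongrightarrow> 0"
      "(\<lambda>i. Bochner_Integration.simple_bochner_integral M (s i)) \<longlonglongrightarrow> x"
    using f unfolding has_strong_bochner_integral_def by blast
  have sm: "strongly_measurable M (s i)" for i
    using s(1) by (intro strongly_measurable_simple) (simp add: simple_bochner_integrable_simple)
  have bound: "ennreal (norm (Bochner_Integration.simple_bochner_integral M (s i)))
      \<le> (\<integral>\<^sup>+t. norm (f t) \<partial>M) + (\<integral>\<^sup>+t. norm (f t - s i t) \<partial>M)" for i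
  proof (rule order_trans[OF norm_simple_bochner_integral_le[OF s(1)]], rule nn_integral_norm_triangle)
    show "strongly_measurable M (\<lambda>t. f t - s i t)" by (rule strongly_measurable_diff[OF m sm])
    show "norm (s i t) \<le> norm (f t) + norm (f t - s i t)" for t
      by (metis norm_minus_commute norm_triangle_sub)
  qed (rule m)
  have "(\<lambda>i. ennreal (norm (Bochner_Integration.simple_bochner_integral M (s i)))) \<longlonglongrightarrow> ennreal (norm x)"
    by (intro tendsto_ennrealI tendsto_norm s(3))
  moreover have "(\<lambda>i. (\<integral>\<^sup>+t. norm (f t) \<partial>M) + (\<integral>\<^sup>+t. norm (f t - s i t) \<partial>M)) \<longlonglongrightarrow> (\<integral>\<^sup>+t. norm (f t) \<partial>M) + 0"
    by (intro tendsto_add tendsto_const s(2))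
  ultimately have "ennreal (norm x) \<le> (\<integral>\<^sup>+t. norm (f t) \<partial>M) + 0"
    by (rule LIMSEQ_le) (use bound in blast)
  then show ?thesis by simp
qed

lemma has_integral_add:
  assumes f: "has_strong_bochner_integral M f x" and g: "has_strong_bochner_integral M g y"
  shows "has_strong_bochner_integral M (\<lambda>t. f t + g t) (x + y)"
proof -
  obtain s where m: "strongly_measurable M f"
    and s: "\<And>i. Bochner_Integration.simple_bochner_integrable M (s i)"
      "(\<lambda>i. \<integral>\<^sup>+ t. norm (f t - s i t) \<partial>M) \<longlonglongrightarrow> 0"
      "(\<lambda>i. Bochner_Integration.simple_bochner_integral M (s i)) \<longlonglongrightarrow> x"
    using f unfolding has_strong_bochner_integral_def by blast
  obtain r where n: "strongly_measurable M g"
    and r: "\<And>i. Bochner_Integration.simple_bochner_integrable M (r i)"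
      "(\<lambda>i. \<integral>\<^sup>+ t. norm (g t - r i t) \<partial>M) \<longlonglongrightarrow> 0"
      "(\<lambda>i. Bochner_Integration.simple_bochner_integral M (r i)) \<longlonglongrightarrow> y"
    using g unfolding has_strong_bochner_integral_def by blast
  have sm: "strongly_measurable M (s i)" "strongly_measurable M (r i)" for i
    using s(1) r(1) by (auto intro!: strongly_measurable_simple simp: simple_bochner_integrable_simple)
  have "(\<integral>\<^sup>+t. norm (f t + g t - (s i t + r i t)) \<partial>M)
      \<le> (\<integral>\<^sup>+t. norm (f t - s i t) \<partial>M) + (\<integral>\<^sup>+t. norm (g t - r i t) \<partial>M)" for i
    by (intro nn_integral_norm_triangle strongly_measurable_diff m n sm norm_diff_triangle_ineq)
  moreover have "(\<lambda>i. (\<integral>\<^sup>+t. norm (f t - s i t) \<partial>M) + (\<integral>\<^sup>+t. norm (g t - r i t) \<partial>M)) \<longlonglongrightarrow> 0"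
    using tendsto_add[OF s(2) r(2)] by simp
  ultimately have "(\<lambda>i. \<integral>\<^sup>+t. norm (f t + g t - (s i t + r i t)) \<partial>M) \<longlonglongrightarrow> 0"
    by (rule ennreal_LIMSEQ_zero_mono)
  moreover have "(\<lambda>i. Bochner_Integration.simple_bochner_integral M (\<lambda>t. s i t + r i t)) \<longlonglongrightarrow> x + y"
    using tendsto_add[OF s(3) r(3)] by (simp add: Bochner_Integration.simple_bochner_integral_add[OF s(1) r(1)])
  moreover have "Bochner_Integration.simple_bochner_integrable M (\<lambda>t. s i t + r i t)" for i
    using s(1) r(1) by (simp add: simple_bochner_integrable_simple)
  ultimately show ?thesis
    using strongly_measurable_add[OF m n] unfolding has_strong_bochner_integral_def
    by (intro conjI exI[of _ "\<lambda>i t. s i t + r i t"]) auto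
qed

lemma has_integral_scaleR:
  assumes f: "has_strong_bochner_integral M f x"
  shows "has_strong_bochner_integral M (\<lambda>t. c *\<^sub>R f t) (c *\<^sub>R x)"
proof -
  obtain s where m: "strongly_measurable M f"
    and s: "\<And>i. Bochner_Integration.simple_bochner_integrable M (s i)"
      "(\<lambda>i. \<integral>\<^sup>+ t. norm (f t - s i t) \<partial>M) \<longlonglongrightarrow> 0"
      "(\<lambda>i. Bochner_Integration.simple_bochner_integral M (s i)) \<longlonglongrightarrow> x"
    using f unfolding has_strong_bochner_integral_def by blast
  have sm: "strongly_measurable M (s i)" for i
    using s(1) by (auto intro!: strongly_measurable_simple simp: simple_bochner_integrable_simple)
  have "(\<integral>\<^sup>+t. norm (c *\<^sub>R f t - c *\<^sub>R s i t) \<partial>M) = ennreal \<bar>c\<bar> * (\<integral>\<^sup>+t. norm (f t - s i t) \<partial>M)" for i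
    using nn_integral_norm_scaleR[OF strongly_measurable_diff[OF m sm[of i]], of c]
    by (simp add: scaleR_diff_right)
  moreover have "(\<lambda>i. ennreal \<bar>c\<bar> * (\<integral>\<^sup>+t. norm (f t - s i t) \<partial>M)) \<longlonglongrightarrow> ennreal \<bar>c\<bar> * 0"
    by (intro ennreal_tendsto_cmult s(2)) simp
  ultimately have "(\<lambda>i. \<integral>\<^sup>+t. norm (c *\<^sub>R f t - c *\<^sub>R s i t) \<partial>M) \<longlonglongrightarrow> 0" by simp
  moreover have "Bochner_Integration.simple_bochner_integral M (\<lambda>t. c *\<^sub>R s i t)
      = c *\<^sub>R Bochner_Integration.simple_bochner_integral M (s i)" for i
    by (rule Bochner_Integration.simple_bochner_integral_linear[OF _ s(1)]) (rule linear_scale_self)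
  then have "(\<lambda>i. Bochner_Integration.simple_bochner_integral M (\<lambda>t. c *\<^sub>R s i t)) \<longlonglongrightarrow> c *\<^sub>R x"
    using tendsto_scaleR[OF tendsto_const s(3)] by simp
  moreover have "Bochner_Integration.simple_bochner_integrable M (\<lambda>t. c *\<^sub>R s i t)" for i
    using s(1) by (simp add: simple_bochner_integrable_simple simple_function_compose1)
  ultimately show ?thesis
    using strongly_measurable_scaleR[OF m] unfolding has_strong_bochner_integral_def
    by (intro conjI exI[of _ "\<lambda>i t. c *\<^sub>R s i t"]) auto
qed

lemma has_integral_unique:
  assumes "has_strong_bochner_integral M f x" "has_strong_bochner_integral M f y"
  shows "x = y"
proof -
  have "has_strong_bochner_integral M (\<lambda>t. f t + (-1) *\<^sub>R f t) (x + (-1) *\<^sub>R y)"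
    by (intro has_integral_add has_integral_scaleR assms)
  from norm_integral_le[OF this] show ?thesis by simp
qed

text \<open>Cutting the approximating simple functions off where they exceed twice the norm of the limit keeps
the pointwise convergence and provides the dominating function \<open>3 * norm (f t)\<close>.\<close>
lemma simple_L1_approximation:
  assumes f: "strongly_measurable M f" and fin: "(\<integral>\<^sup>+t. norm (f t) \<partial>M) < \<infinity>"
  shows "\<exists>s. (\<forall>i. simple_function M (s i)) \<and> (\<lambda>i. \<integral>\<^sup>+ t. norm (f t - s i t) \<partial>M) \<longlonglongrightarrow> 0"
proof -
  obtain s where s: "\<And>i. simple_function M (s i)" "AE x in M. (\<lambda>i. s i x) \<longlonglongrightarrow> f x"
    using f unfolding strongly_measurable_def by blast
  define r where "r i x = (if norm (s i x) \<le> 2 * norm (f x) then s i x else 0)" for i x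
  have nf[measurable]: "(\<lambda>x. norm (f x)) \<in> borel_measurable M" by (rule strongly_measurable_norm[OF f])
  have ns[measurable]: "(\<lambda>x. norm (s i x)) \<in> borel_measurable M" for i
    by (rule strongly_measurable_norm[OF strongly_measurable_simple[OF s(1)]])
  have r: "simple_function M (r i)" for i
    unfolding r_def by (intro simple_function_If s(1) simple_function_const) measurable
  have fr[measurable]: "(\<lambda>x. norm (f x - r i x)) \<in> borel_measurable M" for i
    by (intro strongly_measurable_norm strongly_measurable_diff f strongly_measurable_simple r)
  have "(\<lambda>i. \<integral>\<^sup>+ t. norm (0 - norm (f t - r i t)) \<partial>M) \<longlonglongrightarrow> 0"
  proof (rule nn_integral_dominated_convergence_norm[where w = "\<lambda>t. 3 * norm (f t)"])
    have "norm (f t - r i t) \<le> 3 * norm (f t)" for t i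
      using norm_triangle_ineq4[of "f t" "r i t"] by (auto simp: r_def)
    then show "AE t in M. norm (norm (f t - r i t)) \<le> 3 * norm (f t)" for i by simp
    have "(\<integral>\<^sup>+t. ennreal (3 * norm (f t)) \<partial>M) = 3 * (\<integral>\<^sup>+t. norm (f t) \<partial>M)"
      by (simp add: ennreal_mult nn_integral_cmult)
    then show "(\<integral>\<^sup>+t. ennreal (3 * norm (f t)) \<partial>M) < \<infinity>"
      using fin by (simp add: ennreal_mult_less_top)
    show "AE t in M. (\<lambda>i. norm (f t - r i t)) \<longlonglongrightarrow> 0"
      using s(2)
    proof eventually_elim
      case (elim t)
      have "(\<lambda>i. r i t) \<longlonglongrightarrow> f t"
      proof (cases "f t = 0")
        case True
        then have "r i t = 0" for i by (auto simp: r_def)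
        then show ?thesis using True by simp
      next
        case False
        then have "\<forall>\<^sub>F i in sequentially. norm (s i t) < 2 * norm (f t)"
          by (intro order_tendstoD(2)[OF tendsto_norm[OF elim]]) simp
        then have "\<forall>\<^sub>F i in sequentially. s i t = r i t"
          by eventually_elim (simp add: r_def)
        then show ?thesis by (rule Lim_transform_eventually[OF elim])
      qed
      then have "(\<lambda>i. norm (f t - r i t)) \<longlonglongrightarrow> norm (f t - f t)"
        by (intro tendsto_norm tendsto_diff tendsto_const)
      then show ?case by simp
    qed
  qed measurable
  then show ?thesis using r by (intro exI[of _ r]) simp
qed

lemma has_integral_exists:
  fixes f :: "'a \<Rightarrow> 'b::banach"
  assumes f: "strongly_measurable M f" and fin: "(\<integral>\<^sup>+t. norm (f t) \<partial>M) < \<infinity>"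
  shows "\<exists>x. has_strong_bochner_integral M f x"
proof -
  obtain s where s: "\<And>i. simple_function M (s i)" 
      and lim: "(\<lambda>i. \<integral>\<^sup>+ t. norm (f t - s i t) \<partial>M) \<longlonglongrightarrow> 0"
    using simple_L1_approximation[OF assms] by blast
  have si: "Bochner_Integration.simple_bochner_integrable M (s i)" for i
    by (simp add: simple_bochner_integrable_simple s)
  define I where "I i = Bochner_Integration.simple_bochner_integral M (s i)" for i
  have le: "ennreal (norm (I i - I j)) \<le> (\<integral>\<^sup>+ t. norm (f t - s i t) \<partial>M) + (\<integral>\<^sup>+ t. norm (f t - s j t) \<partial>M)" for i j
  proof -
    have "I i - I j = Bochner_Integration.simple_bochner_integral M (\<lambda>t. s i t - s j t)"
      unfolding I_def by (rule Bochner_Integration.simple_bochner_integral_diff[OF si si, symmetric])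
    also have "ennreal (norm \<dots>) \<le> (\<integral>\<^sup>+t. norm (s i t - s j t) \<partial>M)"
      by (intro norm_simple_bochner_integral_le) (simp add: simple_bochner_integrable_simple s)
    also have "\<dots> \<le> (\<integral>\<^sup>+ t. norm (f t - s i t) \<partial>M) + (\<integral>\<^sup>+ t. norm (f t - s j t) \<partial>M)"
      by (intro nn_integral_norm_triangle strongly_measurable_diff f strongly_measurable_simple s)
         (metis norm_diff_triangle_le norm_minus_commute order_refl)
    finally show ?thesis .
  qed
  have "Cauchy I"
  proof (rule metric_CauchyI)
    fix e :: real assume e: "e > 0"
    then have "\<forall>\<^sub>F i in sequentially. (\<integral>\<^sup>+ t. norm (f t - s i t) \<partial>M) < ennreal (e / 2)"
      by (intro order_tendstoD(2)[OF lim]) simp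
    then obtain N where N: "\<And>i. i \<ge> N \<Longrightarrow> (\<integral>\<^sup>+ t. norm (f t - s i t) \<partial>M) < ennreal (e / 2)"
      unfolding eventually_sequentially by blast
    have "dist (I i) (I j) < e" if "i \<ge> N" "j \<ge> N" for i j
    proof -
      have "ennreal (norm (I i - I j)) < ennreal (e / 2) + ennreal (e / 2)"
        by (rule order_le_less_trans[OF le add_strict_mono[OF N[OF that(1)] N[OF that(2)]]])
      also have "\<dots> = ennreal e" using e by (simp flip: ennreal_plus)
      finally show ?thesis using e by (simp add: dist_norm ennreal_less_iff)
    qed
    then show "\<exists>N. \<forall>i\<ge>N. \<forall>j\<ge>N. dist (I i) (I j) < e" by blast
  qed
  then obtain x where "I \<longlonglongrightarrow> x" using Cauchy_convergent_iff convergent_def by blast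
  then show ?thesis
    using f si lim unfolding has_strong_bochner_integral_def I_def by blast
qed

text \<open>Approximating the \<open>n\<close>-th function in the mean up to \<open>(1/2) ^ n\<close> makes the errors summable in the
mean, hence summable almost everywhere, so that they tend to zero and the diagonal sequence of
simple functions converges to the same limit.\<close>
lemma strongly_measurable_AE_LIMSEQ:
  assumes f: "\<And>n. strongly_measurable M (f n)" and fin: "\<And>n::nat. (\<integral>\<^sup>+t. norm (f n t) \<partial>M) < \<infinity>"
    and lim: "AE t in M. (\<lambda>n. f n t) \<longlonglongrightarrow> g t"
  shows "strongly_measurable M g"
proof -
  have "\<exists>s. simple_function M s \<and> (\<integral>\<^sup>+ t. norm (f n t - s t) \<partial>M) < ennreal ((1/2) ^ n)" for n
  proof -
    obtain s where s: "\<And>i. simple_function M (s i)" 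
      and lim: "(\<lambda>i. \<integral>\<^sup>+ t. norm (f n t - s i t) \<partial>M) \<longlonglongrightarrow> 0"
      using simple_L1_approximation[OF f fin] by blast
    have "\<forall>\<^sub>F i in sequentially. (\<integral>\<^sup>+ t. norm (f n t - s i t) \<partial>M) < ennreal ((1/2) ^ n)"
      by (intro order_tendstoD(2)[OF lim]) simp
    then show ?thesis using s eventually_happens'[OF sequentially_bot] by blast
  qed
  then obtain s where s: "\<And>n. simple_function M (s n)"
      "\<And>n. (\<integral>\<^sup>+ t. norm (f n t - s n t) \<partial>M) < ennreal ((1/2) ^ n)" by metis
  have m: "(\<lambda>t. ennreal (norm (f n t - s n t))) \<in> borel_measurable M" for n
    by (intro measurable_compose[OF _ measurable_ennreal] strongly_measurable_norm strongly_measurable_diff f strongly_measurable_simple s)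
  have "(\<integral>\<^sup>+t. (\<Sum>n. ennreal (norm (f n t - s n t))) \<partial>M) = (\<Sum>n. \<integral>\<^sup>+ t. norm (f n t - s n t) \<partial>M)"
    by (intro nn_integral_suminf m)
  also have "\<dots> \<le> (\<Sum>n. ennreal ((1/2) ^ n))"
    by (intro suminf_le summableI less_imp_le[OF s(2)])
  also have "\<dots> < \<infinity>"
    by (simp add: suminf_ennreal2 summable_geometric)
  finally have "AE t in M. (\<Sum>n. ennreal (norm (f n t - s n t))) \<noteq> \<infinity>"
    by (intro nn_integral_PInf_AE borel_measurable_suminf_order m) auto
  then have "AE t in M. (\<lambda>n. s n t) \<longlonglongrightarrow> g t"
    using lim
  proof eventually_elim
    case (elim t)
    have "(\<lambda>n. norm (f n t - s n t)) \<longlonglongrightarrow> 0"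
      using elim(1) by (intro summable_LIMSEQ_zero summable_suminf_not_top) auto
    then have "(\<lambda>n. f n t - s n t) \<longlonglongrightarrow> 0" by (rule tendsto_norm_zero_cancel)
    from tendsto_diff[OF elim(2) this] show ?case by simp
  qed
  with s(1) show ?thesis unfolding strongly_measurable_def by blast
qed

end

section \<open>Lebesgue--Bochner spaces by their balls\<close>

text \<open>Membership in the ball of radius \<open>c\<close>, expressed for finite \<open>p\<close> by the integral of the \<open>p\<close>-th power
itself rather than by its root. Convexity and the Fatou property of balls are immediate in this
form, and the triangle inequality follows from convexity.\<close>
definition Lp_bound :: "'a measure \<Rightarrow> ereal \<Rightarrow> real \<Rightarrow> ('a \<Rightarrow> 'b::real_normed_vector) \<Rightarrow> bool" where
  "Lp_bound M p c u \<longleftrightarrow> strongly_measurable M u \<and>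
     (if p = \<infinity> then AE x in M. norm (u x) \<le> c
      else (\<integral>\<^sup>+x. ennreal (norm (u x) powr real_of_ereal p) \<partial>M) \<le> ennreal (c powr real_of_ereal p))"

lemma convex_powr_nonneg:
  fixes x y a b q :: real
  assumes "0 \<le> x" "0 \<le> y" "0 \<le> a" "0 \<le> b" "a + b = 1" "1 \<le> q"
  shows "(a * x + b * y) powr q \<le> a * x powr q + b * y powr q"
proof -
  have le: "(c * z) powr q \<le> c * z powr q" if "0 \<le> c" "c \<le> 1" "0 \<le> z" for c z
  proof -
    have "c powr q \<le> c" using powr_mono'[of 1 q c] that assms(6) by (cases "c = 0") auto
    then show ?thesis using that by (simp add: powr_mult mult_right_mono)
  qed
  consider "x = 0" | "y = 0" | "0 < x" "0 < y" using assms by fastforce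
  then show ?thesis
  proof cases
    case 3
    have a: "a = 1 - b" using assms(5) by simp
    show ?thesis
      using convex_onD[OF powr_convex[OF assms(6)], of b x y] 3 assms(3,4) unfolding a by simp
  qed (use le[of b y] le[of a x] assms in auto)
qed

context finite_complete_measure
begin

lemma powr_norm_measurable:
  "strongly_measurable M u \<Longrightarrow> (\<lambda>x. norm (u x) powr q) \<in> borel_measurable M"
  using strongly_measurable_norm by measurable

lemma powr_norm_ennreal_measurable:
  "strongly_measurable M u \<Longrightarrow> (\<lambda>x. ennreal (norm (u x) powr q)) \<in> borel_measurable M"
  by (rule measurable_compose[OF powr_norm_measurable measurable_ennreal])

lemma Lp_bound_iff:
  assumes p: "1 < p" and c: "0 < c"
  shows "Lp_bound M p c u \<longleftrightarrow> u \<in> Lp_space M p \<and> Lp_norm M p u \<le> c"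
proof (cases "strongly_measurable M u")
  case True
  note m = strongly_measurable_norm[OF True]
  show ?thesis
  proof (cases "p = \<infinity>")
    case inf: True
    define e where "e = esssup M (\<lambda>x. ereal (norm (u x)))"
    have me: "(\<lambda>x. ereal (norm (u x))) \<in> borel_measurable M" using m by measurable
    have "(AE x in M. ereal (norm (u x)) \<le> ereal c) \<longleftrightarrow> e \<le> ereal c"
    proof
      assume "e \<le> ereal c"
      have "AE x in M. ereal (norm (u x)) \<le> e" unfolding e_def by (rule esssup_AE)
      then show "AE x in M. ereal (norm (u x)) \<le> ereal c"
        by eventually_elim (rule order_trans[OF _ \<open>e \<le> ereal c\<close>])
    qed (unfold e_def, rule esssup_I[OF me])
    also have "\<dots> \<longleftrightarrow> e < \<infinity> \<and> real_of_ereal e \<le> c" using c by (cases e) auto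
    finally show ?thesis
      using True inf by (simp add: Lp_bound_def Lp_space_def Lp_norm_def e_def)
  next
    case False
    then obtain q where q: "p = ereal q" "1 < q" using p by (cases p) auto
    define I where "I = (LINT x|M. norm (u x) powr q)"
    have I0: "I \<ge> 0" unfolding I_def by (intro integral_nonneg_AE) auto
    have eq: "(\<integral>\<^sup>+x. ennreal (norm (u x) powr q) \<partial>M) = ennreal I"
      if "integrable M (\<lambda>x. norm (u x) powr q)"
      unfolding I_def by (rule nn_integral_eq_integral[OF that]) auto
    have "I powr (1 / q) \<le> c \<longleftrightarrow> I \<le> c powr q"
    proof
      assume "I powr (1 / q) \<le> c"
      then have "(I powr (1 / q)) powr q \<le> c powr q" using q by (intro powr_mono2) auto
      then show "I \<le> c powr q" using q I0 by (simp add: powr_powr)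
    next
      assume "I \<le> c powr q"
      then have "I powr (1 / q) \<le> (c powr q) powr (1 / q)" using q I0 by (intro powr_mono2) auto
      then show "I powr (1 / q) \<le> c" using q c by (simp add: powr_powr)
    qed
    moreover have "integrable M (\<lambda>x. norm (u x) powr q)"
      if "(\<integral>\<^sup>+x. ennreal (norm (u x) powr q) \<partial>M) \<le> ennreal (c powr q)"
      using that powr_norm_measurable[OF True, of q]
      by (intro integrableI_bounded) (auto intro: le_less_trans)
    ultimately show ?thesis
      using True q eq by (auto simp: Lp_bound_def Lp_space_def Lp_norm_def I_def[symmetric])
  qed
qed (auto simp: Lp_bound_def Lp_space_def)

lemma Lp_space_iff_bound:
  assumes p: "1 < p"
  shows "u \<in> Lp_space M p \<longleftrightarrow> (\<exists>c>0. Lp_bound M p c u)"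
proof
  assume "u \<in> Lp_space M p"
  then have "Lp_bound M p (max 1 (Lp_norm M p u)) u" by (subst Lp_bound_iff[OF p]) auto
  then show "\<exists>c>0. Lp_bound M p c u" by (intro exI[of _ "max 1 (Lp_norm M p u)"]) auto
qed (use Lp_bound_iff[OF p] in blast)

lemma Lp_bound_scaleR:
  assumes u: "Lp_bound M p c u" and p: "1 < p" and c: "0 \<le> c"
  shows "Lp_bound M p (\<bar>a\<bar> * c) (\<lambda>x. a *\<^sub>R u x)"
proof -
  have m: "strongly_measurable M u" using u by (simp add: Lp_bound_def)
  show ?thesis
  proof (cases "p = \<infinity>")
    case True
    then have "AE x in M. norm (u x) \<le> c" using u by (simp add: Lp_bound_def)
    then have "AE x in M. norm (a *\<^sub>R u x) \<le> \<bar>a\<bar> * c"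
      by eventually_elim (simp add: mult_left_mono)
    then show ?thesis using True strongly_measurable_scaleR[OF m] by (simp add: Lp_bound_def)
  next
    case False
    then obtain q where q: "p = ereal q" "1 < q" using p by (cases p) auto
    have "(\<integral>\<^sup>+x. ennreal (norm (a *\<^sub>R u x) powr q) \<partial>M)
        = ennreal (\<bar>a\<bar> powr q) * (\<integral>\<^sup>+x. ennreal (norm (u x) powr q) \<partial>M)"
      using powr_norm_ennreal_measurable[OF m, of q]
      by (simp add: powr_mult ennreal_mult nn_integral_cmult)
    also have "\<dots> \<le> ennreal (\<bar>a\<bar> powr q) * ennreal (c powr q)"
      using u q by (intro mult_left_mono) (auto simp: Lp_bound_def)
    also have "\<dots> = ennreal ((\<bar>a\<bar> * c) powr q)"
      using c by (simp add: powr_mult ennreal_mult)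
    finally show ?thesis
      using q strongly_measurable_scaleR[OF m] by (simp add: Lp_bound_def)
  qed
qed

lemma Lp_bound_convex:
  assumes u: "Lp_bound M p c u" and v: "Lp_bound M p c v" and p: "1 < p"
    and ab: "0 \<le> a" "0 \<le> b" "a + b = 1"
  shows "Lp_bound M p c (\<lambda>x. a *\<^sub>R u x + b *\<^sub>R v x)"
proof -
  have m: "strongly_measurable M u" "strongly_measurable M v" using u v by (auto simp: Lp_bound_def)
  have mc: "strongly_measurable M (\<lambda>x. a *\<^sub>R u x + b *\<^sub>R v x)"
    by (intro strongly_measurable_add strongly_measurable_scaleR m)
  have tri: "norm (a *\<^sub>R u x + b *\<^sub>R v x) \<le> a * norm (u x) + b * norm (v x)" for x
    using norm_triangle_ineq[of "a *\<^sub>R u x" "b *\<^sub>R v x"] ab by simp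
  show ?thesis
  proof (cases "p = \<infinity>")
    case True
    then have "AE x in M. norm (u x) \<le> c" "AE x in M. norm (v x) \<le> c"
      using u v by (auto simp: Lp_bound_def)
    then have "AE x in M. norm (a *\<^sub>R u x + b *\<^sub>R v x) \<le> c"
    proof eventually_elim
      case (elim x)
      have "a * norm (u x) + b * norm (v x) \<le> a * c + b * c"
        using elim ab by (intro add_mono mult_left_mono) auto
      with tri[of x] ab(3) show ?case by (metis distrib_right mult_1 order_trans)
    qed
    then show ?thesis using True mc by (simp add: Lp_bound_def)
  next
    case False
    then obtain q where q: "p = ereal q" "1 < q" using p by (cases p) auto
    have "norm (a *\<^sub>R u x + b *\<^sub>R v x) powr q \<le> a * norm (u x) powr q + b * norm (v x) powr q" for x
      using q ab by (intro order_trans[OF powr_mono2[OF _ _ tri] convex_powr_nonneg]) auto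
    then have "(\<integral>\<^sup>+x. ennreal (norm (a *\<^sub>R u x + b *\<^sub>R v x) powr q) \<partial>M)
        \<le> (\<integral>\<^sup>+x. ennreal a * ennreal (norm (u x) powr q) + ennreal b * ennreal (norm (v x) powr q) \<partial>M)"
      using ab by (intro nn_integral_mono) (simp flip: ennreal_mult' ennreal_plus)
    also have "\<dots> = ennreal a * (\<integral>\<^sup>+x. ennreal (norm (u x) powr q) \<partial>M)
        + ennreal b * (\<integral>\<^sup>+x. ennreal (norm (v x) powr q) \<partial>M)"
      using powr_norm_ennreal_measurable[OF m(1), of q] powr_norm_ennreal_measurable[OF m(2), of q]
      by (simp add: nn_integral_add nn_integral_cmult)
    also have "\<dots> \<le> ennreal a * ennreal (c powr q) + ennreal b * ennreal (c powr q)"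
      using u v q by (intro add_mono mult_left_mono) (auto simp: Lp_bound_def)
    also have "\<dots> = ennreal (c powr q)"
      using ab by (simp flip: ennreal_mult' ennreal_plus distrib_right)
    finally show ?thesis using q mc by (simp add: Lp_bound_def)
  qed
qed

text \<open>Minkowski's inequality: \<open>u + v\<close> is \<open>c + d\<close> times a convex combination of \<open>u / c\<close> and \<open>v / d\<close>, both of
which lie in the unit ball.\<close>
lemma Lp_bound_add:
  assumes u: "Lp_bound M p c u" and v: "Lp_bound M p d v" and p: "1 < p" and cd: "0 < c" "0 < d"
  shows "Lp_bound M p (c + d) (\<lambda>x. u x + v x)"
proof -
  have "Lp_bound M p 1 (\<lambda>x. (1 / c) *\<^sub>R u x)" "Lp_bound M p 1 (\<lambda>x. (1 / d) *\<^sub>R v x)"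
    using Lp_bound_scaleR[OF u p, of "1 / c"] Lp_bound_scaleR[OF v p, of "1 / d"] cd by simp_all
  from Lp_bound_convex[OF this p, of "c / (c + d)" "d / (c + d)"]
  have "Lp_bound M p 1 (\<lambda>x. (1 / (c + d)) *\<^sub>R (u x + v x))"
    using cd by (simp add: scaleR_add_right add_divide_distrib[symmetric])
  from Lp_bound_scaleR[OF this p, of "c + d"] show ?thesis using cd by simp
qed

lemma Lp_bound_zero:
  assumes "0 \<le> c"
  shows "Lp_bound M p c (\<lambda>x. 0)"
  using assms by (simp add: Lp_bound_def strongly_measurable_const)

lemma Lp_space_add:
  assumes "1 < p" "u \<in> Lp_space M p" "v \<in> Lp_space M p"
  shows "(\<lambda>x. u x + v x) \<in> Lp_space M p"
  using assms Lp_bound_add[OF _ _ assms(1)] unfolding Lp_space_iff_bound[OF assms(1)]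
  by (metis add_pos_pos)

lemma Lp_space_scaleR:
  assumes "1 < p" "u \<in> Lp_space M p"
  shows "(\<lambda>x. a *\<^sub>R u x) \<in> Lp_space M p"
proof (cases "a = 0")
  case True
  then show ?thesis
    using Lp_bound_zero[of 1 p] unfolding Lp_space_iff_bound[OF assms(1)] by (auto intro!: exI[of _ 1])
next
  case False
  obtain c where "c > 0" "Lp_bound M p c u" using assms unfolding Lp_space_iff_bound[OF assms(1)] by blast
  then show ?thesis
    using Lp_bound_scaleR[OF _ assms(1), of c u a] False unfolding Lp_space_iff_bound[OF assms(1)]
    by (intro exI[of _ "\<bar>a\<bar> * c"]) auto
qed

text \<open>\<open>t \<le> 1 + t powr q\<close> for \<open>t \<ge> 0\<close> and \<open>q \<ge> 1\<close> replaces Hoelder's inequality.\<close>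
lemma nn_integral_norm_le_of_Lp_bound:
  assumes u: "Lp_bound M p 1 u" and p: "1 < p"
  shows "(\<integral>\<^sup>+x. norm (u x) \<partial>M) \<le> 1 + emeasure M (space M)"
proof -
  have m: "strongly_measurable M u" using u by (simp add: Lp_bound_def)
  show ?thesis
  proof (cases "p = \<infinity>")
    case True
    then have "AE x in M. norm (u x) \<le> 1" using u by (simp add: Lp_bound_def)
    then have "(\<integral>\<^sup>+x. norm (u x) \<partial>M) \<le> (\<integral>\<^sup>+x. 1 \<partial>M)"
      by (intro nn_integral_mono_AE) (auto elim!: eventually_mono)
    then show ?thesis by (simp add: add_increasing)
  next
    case False
    then obtain q where q: "p = ereal q" "1 < q" using p by (cases p) auto
    have "norm (u x) \<le> norm (u x) powr q + 1" for x
    proof (cases "norm (u x) \<le> 1")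
      case False
      then have "norm (u x) powr 1 \<le> norm (u x) powr q" using q by (intro powr_mono) auto
      then show ?thesis by (simp add: False powr_one)
    qed (simp add: add_increasing)
    then have "(\<integral>\<^sup>+x. norm (u x) \<partial>M) \<le> (\<integral>\<^sup>+x. ennreal (norm (u x) powr q) + 1 \<partial>M)"
      by (intro nn_integral_mono) (metis ennreal_1 ennreal_leI ennreal_plus powr_ge_zero zero_le_one)
    also have "\<dots> = (\<integral>\<^sup>+x. ennreal (norm (u x) powr q) \<partial>M) + emeasure M (space M)"
      using powr_norm_ennreal_measurable[OF m, of q] by (simp add: nn_integral_add)
    also have "\<dots> \<le> 1 + emeasure M (space M)"
      using u q by (intro add_mono) (auto simp: Lp_bound_def)
    finally show ?thesis .
  qed
qed

lemma nn_integral_norm_finite_of_Lp_bound: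
  assumes "Lp_bound M p 1 u" "1 < p"
  shows "(\<integral>\<^sup>+x. norm (u x) \<partial>M) < \<infinity>"
proof -
  have "1 + emeasure M (space M) < \<infinity>" using emeasure_finite by (simp add: less_top[symmetric])
  with nn_integral_norm_le_of_Lp_bound[OF assms] show ?thesis by (rule le_less_trans)
qed

text \<open>Fatou's lemma for finite \<open>p\<close>. Strong measurability of the limit comes from the fact that bounded
sets of the space are bounded in the mean.\<close>
lemma Lp_bound_AE_LIMSEQ:
  assumes u: "\<And>n. Lp_bound M p 1 (u n)" and p: "1 < p"
    and lim: "AE x in M. (\<lambda>n. u n x) \<longlonglongrightarrow> v x"
  shows "Lp_bound M p 1 v"
proof -
  have m: "strongly_measurable M (u n)" for n using u by (simp add: Lp_bound_def)
  have "(\<integral>\<^sup>+x. norm (u n x) \<partial>M) < \<infinity>" for n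
    by (rule nn_integral_norm_finite_of_Lp_bound[OF u p])
  then have mv: "strongly_measurable M v" by (rule strongly_measurable_AE_LIMSEQ[OF m _ lim])
  show ?thesis
  proof (cases "p = \<infinity>")
    case True
    then have "AE x in M. \<forall>n. norm (u n x) \<le> 1" using u by (simp add: Lp_bound_def AE_all_countable)
    then have "AE x in M. norm (v x) \<le> 1"
      using lim
    proof eventually_elim
      case (elim x)
      show ?case by (rule LIMSEQ_le_const2[OF tendsto_norm[OF elim(2)]]) (use elim(1) in blast)
    qed
    then show ?thesis using True mv by (simp add: Lp_bound_def)
  next
    case False
    then obtain q where q: "p = ereal q" "1 < q" using p by (cases p) auto
    have "(\<integral>\<^sup>+x. ennreal (norm (v x) powr q) \<partial>M) = (\<integral>\<^sup>+x. liminf (\<lambda>n. ennreal (norm (u n x) powr q)) \<partial>M)"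
    proof (rule nn_integral_cong_AE, use lim in eventually_elim)
      case (elim x)
      have "(\<lambda>n. ennreal (norm (u n x) powr q)) \<longlonglongrightarrow> ennreal (norm (v x) powr q)"
        using q by (intro tendsto_ennrealI tendsto_powr' tendsto_norm tendsto_const elim) auto
      then show ?case by (intro lim_imp_Liminf[symmetric]) auto
    qed
    also have "\<dots> \<le> liminf (\<lambda>n. \<integral>\<^sup>+x. ennreal (norm (u n x) powr q) \<partial>M)"
      by (intro nn_integral_liminf powr_norm_ennreal_measurable m)
    also have "\<dots> \<le> liminf (\<lambda>n. 1 :: ennreal)"
      using u q by (intro Liminf_mono always_eventually) (simp add: Lp_bound_def)
    also have "\<dots> = 1" by (simp add: Liminf_const)
    finally show ?thesis using q mv by (simp add: Lp_bound_def)
  qed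
qed

text \<open>Splitting off the first term presents the sum as the midpoint of \<open>u N\<close> and of the sum for the shifted
sequence.\<close>
lemma Lp_bound_dyadic_sum:
  assumes u: "\<And>n. Lp_bound M p 1 (u n)" and p: "1 < p"
  shows "Lp_bound M p 1 (\<lambda>x. \<Sum>n<m. (1/2) ^ Suc n *\<^sub>R u (N + n) x)"
proof (induction m arbitrary: N)
  case 0
  then show ?case by (simp add: Lp_bound_zero)
next
  case (Suc m)
  have "Lp_bound M p 1 (\<lambda>x. (1/2) *\<^sub>R u N x + (1/2) *\<^sub>R (\<Sum>n<m. (1/2) ^ Suc n *\<^sub>R u (Suc N + n) x))"
    by (intro Lp_bound_convex u Suc p) auto
  moreover have "(\<Sum>n<Suc m. (1/2) ^ Suc n *\<^sub>R u (N + n) x)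
      = (1/2) *\<^sub>R u N x + (1/2) *\<^sub>R (\<Sum>n<m. (1/2) ^ Suc n *\<^sub>R u (Suc N + n) x)" for x
    by (subst sum.lessThan_Suc_shift) (simp add: scaleR_sum_right)
  ultimately show ?case by (simp only:)
qed

text \<open>Completeness, in the form required for a Banach disk. The dyadic series converges almost everywhere
because it converges absolutely in the mean. Its \<open>N\<close>-th remainder, magnified by \<open>2 ^ N\<close>, is the
dyadic series of the sequence shifted by \<open>N\<close>, so it lies in the unit ball as well; this gives the
rate of convergence without any further estimate.\<close>
lemma Lp_dyadic_series:
  fixes u :: "nat \<Rightarrow> 'a \<Rightarrow> 'b::banach"
  assumes u: "\<And>n. Lp_bound M p 1 (u n)" and p: "1 < p"
  shows "\<exists>v. \<forall>N. Lp_bound M p 1 (\<lambda>x. 2 ^ N *\<^sub>R (v x - (\<Sum>n<N. (1/2) ^ Suc n *\<^sub>R u n x)))"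
proof -
  define f where "f n x = (1/2) ^ Suc n *\<^sub>R u n x" for n x
  define C where "C = 1 + emeasure M (space M)"
  have C: "C < \<infinity>" using emeasure_finite by (simp add: C_def less_top[symmetric])
  have m: "strongly_measurable M (u n)" for n using u by (simp add: Lp_bound_def)
  have fm: "(\<lambda>x. ennreal (norm (f n x))) \<in> borel_measurable M" for n
    unfolding f_def
    by (intro measurable_compose[OF _ measurable_ennreal] strongly_measurable_norm strongly_measurable_scaleR m)
  have "(\<integral>\<^sup>+x. (\<Sum>n. ennreal (norm (f n x))) \<partial>M) = (\<Sum>n. \<integral>\<^sup>+x. ennreal (norm (f n x)) \<partial>M)"
    by (intro nn_integral_suminf fm)
  also have "\<dots> \<le> (\<Sum>n. ennreal ((1/2) ^ Suc n) * C)"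
  proof (intro suminf_le summableI)
    fix n
    have "(\<integral>\<^sup>+x. ennreal (norm (f n x)) \<partial>M) = ennreal ((1/2) ^ Suc n) * (\<integral>\<^sup>+x. norm (u n x) \<partial>M)"
      unfolding f_def by (subst nn_integral_norm_scaleR[OF m]) (simp del: power_Suc)
    also have "\<dots> \<le> ennreal ((1/2) ^ Suc n) * C"
      unfolding C_def by (intro mult_left_mono nn_integral_norm_le_of_Lp_bound[OF u p]) simp
    finally show "(\<integral>\<^sup>+x. ennreal (norm (f n x)) \<partial>M) \<le> ennreal ((1/2) ^ Suc n) * C" .
  qed
  also have "\<dots> = (\<Sum>n. ennreal ((1/2) ^ Suc n)) * C" by (rule ennreal_suminf_multc)
  also have "(\<Sum>n. ennreal ((1/2) ^ Suc n)) = ennreal 1"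
    by (rule suminf_ennreal_eq[OF _ power_half_series]) simp
  finally have "(\<integral>\<^sup>+x. (\<Sum>n. ennreal (norm (f n x))) \<partial>M) < \<infinity>" using C by (simp add: le_less_trans)
  then have "AE x in M. (\<Sum>n. ennreal (norm (f n x))) \<noteq> \<infinity>"
    by (intro nn_integral_PInf_AE borel_measurable_suminf_order fm) auto
  then have sm: "AE x in M. summable (\<lambda>n. f n x)"
    by eventually_elim (rule summable_norm_cancel[OF summable_suminf_not_top]; simp)
  have "Lp_bound M p 1 (\<lambda>x. 2 ^ N *\<^sub>R ((\<Sum>n. f n x) - (\<Sum>n<N. f n x)))" for N
  proof (rule Lp_bound_AE_LIMSEQ[OF Lp_bound_dyadic_sum[OF u p] p], use sm in eventually_elim)
    case (elim x)
    have "(\<lambda>n. f (n + N) x) sums ((\<Sum>n. f n x) - (\<Sum>n<N. f n x))"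
      using summable_sums[OF elim] by (simp add: sums_iff_shift[of "\<lambda>n. f n x" N])
    then have "(\<lambda>n. 2 ^ N *\<^sub>R f (n + N) x) sums (2 ^ N *\<^sub>R ((\<Sum>n. f n x) - (\<Sum>n<N. f n x)))"
      by (rule sums_scaleR_right)
    moreover have "2 ^ N *\<^sub>R f (n + N) x = (1/2) ^ Suc n *\<^sub>R u (N + n) x" for n
      by (simp add: f_def power_add power_one_over add.commute)
    ultimately show "(\<lambda>m. \<Sum>n<m. (1/2) ^ Suc n *\<^sub>R u (N + n) x)
        \<longlonglongrightarrow> 2 ^ N *\<^sub>R ((\<Sum>n. f n x) - (\<Sum>n<N. f n x))"
      by (simp only: sums_def)
  qed
  then show ?thesis by (intro exI[of _ "\<lambda>x. \<Sum>n. f n x"]) (simp only: f_def simp_thms)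
qed

end

section \<open>The control-to-state map\<close>

text \<open>The uniform boundedness principle: the vectors of norm at most one on which all the operators are
bounded by one form an absorbing Banach disk, which therefore contains a ball.\<close>
lemma strong_continuity_bounded:
  fixes \<Phi> :: "'s::topological_space \<Rightarrow> 'y::banach \<Rightarrow>\<^sub>L 'z::banach"
  assumes D: "compact D" and cont: "\<And>y. continuous_on D (\<lambda>s. \<Phi> s y)"
  shows "\<exists>C>0. \<forall>s\<in>D. norm (\<Phi> s) \<le> C"
proof -
  define K where "K = {y. norm y \<le> 1 \<and> (\<forall>s\<in>D. norm (\<Phi> s y) \<le> 1)}"
  interpret banach_disk K
  proof
    show "K \<noteq> {}" by (auto simp: K_def intro!: exI[of _ 0])
    show "convex K"
    proof -
      have "K = cball 0 1 \<inter> (\<Inter>s\<in>D. (\<lambda>y. \<Phi> s y) -` cball 0 1)"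
        by (auto simp: K_def)
      also have "convex \<dots>"
        by (intro convex_Int convex_INT convex_cball convex_linear_vimage
              bounded_linear.linear[OF blinfun.bounded_linear_right])
      finally show ?thesis .
    qed
    show "c *\<^sub>R x \<in> K" if "\<bar>c\<bar> \<le> 1" "x \<in> K" for c x
      using that by (auto simp: K_def blinfun.scaleR_right mult_le_one)
    show "\<exists>y\<in>K. (\<lambda>n. (1/2) ^ Suc n *\<^sub>R x n) sums y" if x: "\<And>n. x n \<in> K" for x
    proof -
      have le: "norm ((1/2) ^ Suc n *\<^sub>R x n) \<le> (1/2) ^ Suc n" for n
        using x[of n] by (simp add: K_def)
      note S = sums_summable[OF power_half_series]
      have sm: "summable (\<lambda>n. (1/2) ^ Suc n *\<^sub>R x n)" by (rule summable_comparison_test'[OF S le])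
      define y where "y = (\<Sum>n. (1/2) ^ Suc n *\<^sub>R x n)"
      have y: "(\<lambda>n. (1/2) ^ Suc n *\<^sub>R x n) sums y" unfolding y_def by (rule summable_sums[OF sm])
      have "norm y \<le> 1"
        using norm_suminf_le[OF le S] sums_unique[OF power_half_series] by (simp add: y_def)
      moreover have "norm (\<Phi> s y) \<le> 1" if s: "s \<in> D" for s
      proof -
        have "(\<lambda>n. \<Phi> s ((1/2) ^ Suc n *\<^sub>R x n)) sums \<Phi> s y"
          by (rule bounded_linear.sums[OF blinfun.bounded_linear_right y])
        moreover have "norm (\<Phi> s ((1/2) ^ Suc n *\<^sub>R x n)) \<le> (1/2) ^ Suc n" for n
          using x[of n] s by (simp add: K_def blinfun.scaleR_right)
        ultimately show ?thesis
          by (rule norm_sums_le[OF _ power_half_series])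
      qed
      ultimately show ?thesis using y by (auto simp: K_def)
    qed
  qed
  have "\<exists>n::nat. \<exists>k\<in>K. y = real n *\<^sub>R k" for y
  proof -
    have "bounded ((\<lambda>s. \<Phi> s y) ` D)"
      by (intro compact_imp_bounded compact_continuous_image cont D)
    then obtain b where b: "\<And>s. s \<in> D \<Longrightarrow> norm (\<Phi> s y) \<le> b" by (auto simp: bounded_iff)
    obtain n :: nat where n: "max (max b (norm y)) 0 < n" using reals_Archimedean2 by blast
    have "norm (\<Phi> s ((1 / real n) *\<^sub>R y)) \<le> 1" if "s \<in> D" for s
      using b[OF that] n by (simp add: blinfun.scaleR_right field_simps)
    then have "(1 / real n) *\<^sub>R y \<in> K" using n by (auto simp: K_def field_simps)
    moreover have "y = real n *\<^sub>R ((1 / real n) *\<^sub>R y)" using n by simp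
    ultimately show ?thesis by blast
  qed
  then obtain r where r: "r > 0" "ball 0 r \<subseteq> K" using contains_ball_if_absorbing by blast
  have "norm (\<Phi> s) \<le> 2 / r" if s: "s \<in> D" for s
  proof (rule norm_blinfun_bound)
    fix y
    show "norm (\<Phi> s y) \<le> 2 / r * norm y"
    proof (cases "y = 0")
      case False
      have "(r / (2 * norm y)) *\<^sub>R y \<in> ball 0 r" using r False by simp
      then have "norm (\<Phi> s ((r / (2 * norm y)) *\<^sub>R y)) \<le> 1" using r(2) s unfolding K_def by blast
      then show ?thesis using r False by (simp add: blinfun.scaleR_right field_simps)
    qed simp
  qed (use r in simp)
  then show ?thesis using r by (intro exI[of _ "2 / r"]) auto
qed

text \<open>Simple functions \<open>\<sigma> i\<close> with values in the interval and tending to the identity discretise the operator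
family. Strong continuity gives convergence on a fixed vector, and the uniform bound on the
operators absorbs the error of approximating \<open>g\<close>.\<close>
lemma strongly_measurable_strongly_continuous:
  fixes \<Phi> :: "real \<Rightarrow> 'y::banach \<Rightarrow>\<^sub>L 'z::banach"
  assumes cont: "\<And>y. continuous_on {a..b} (\<lambda>s. \<Phi> s y)" and g: "strongly_measurable (lebesgue_on {a<..<b}) g"
  shows "strongly_measurable (lebesgue_on {a<..<b}) (\<lambda>s. \<Phi> s (g s))"
proof (cases "a \<le> b")
  case True
  let ?M = "lebesgue_on {a<..<b}"
  obtain C where C: "\<And>s. s \<in> {a..b} \<Longrightarrow> norm (\<Phi> s) \<le> C"
    using strong_continuity_bounded[OF compact_Icc cont] by blast
  obtain r where r: "\<And>i. simple_function ?M (r i)" "AE s in ?M. (\<lambda>i. r i s) \<longlonglongrightarrow> g s"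
    using g unfolding strongly_measurable_def by blast
  have "(\<lambda>s::real. s) \<in> borel_measurable ?M" by (intro measurable_restrict_space1 measurable_completion) simp
  from borel_measurable_implies_sequence_metric[OF this, of 0]
  obtain \<tau> where \<tau>: "\<And>i::nat. simple_function ?M (\<tau> i)" "\<And>s. s \<in> space ?M \<Longrightarrow> (\<lambda>i. \<tau> i s) \<longlonglongrightarrow> s"
    by blast
  \<comment> \<open>Clamping to the interval keeps the points where the operators are continuous and bounded.\<close>
  define \<sigma> where "\<sigma> i s = max a (min b (\<tau> i s))" for i s
  have \<sigma>: "\<sigma> i s \<in> {a..b}" for i s using True by (auto simp: \<sigma>_def)
  have \<sigma>_lim: "(\<lambda>i. \<sigma> i s) \<longlonglongrightarrow> s" if "s \<in> space ?M" for s
  proof -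
    have "(\<lambda>i. \<sigma> i s) \<longlonglongrightarrow> max a (min b s)"
      unfolding \<sigma>_def by (intro tendsto_max tendsto_min tendsto_const \<tau>(2) that)
    then show ?thesis using that by simp
  qed
  have "simple_function ?M (\<lambda>s. \<Phi> (\<sigma> i s) (r i s))" for i
    using simple_function_compose2[OF \<tau>(1) r(1), of "\<lambda>t y. \<Phi> (max a (min b t)) y" i i]
    by (simp add: \<sigma>_def)
  moreover have "AE s in ?M. (\<lambda>i. \<Phi> (\<sigma> i s) (r i s)) \<longlonglongrightarrow> \<Phi> s (g s)"
    using r(2) AE_space
  proof eventually_elim
    case (elim s)
    have s: "s \<in> {a..b}" using elim(2) by simp
    have "(\<lambda>i. \<Phi> (\<sigma> i s) (r i s - g s)) \<longlonglongrightarrow> 0"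
    proof (rule Lim_null_comparison)
      have "norm (\<Phi> (\<sigma> i s) (r i s - g s)) \<le> C * norm (r i s - g s)" for i
        by (rule order_trans[OF norm_blinfun mult_right_mono[OF C[OF \<sigma>]]]) simp
      then show "\<forall>\<^sub>F i in sequentially. norm (\<Phi> (\<sigma> i s) (r i s - g s)) \<le> C * norm (r i s - g s)"
        by simp
      have "(\<lambda>i. norm (r i s - g s)) \<longlonglongrightarrow> 0"
        using elim(1) by (simp add: LIM_zero tendsto_norm_zero)
      then show "(\<lambda>i. C * norm (r i s - g s)) \<longlonglongrightarrow> 0" by (rule tendsto_mult_right_zero)
    qed
    moreover have "(\<lambda>i. \<Phi> (\<sigma> i s) (g s)) \<longlonglongrightarrow> \<Phi> s (g s)"
      using continuous_on_tendsto_compose[OF cont \<sigma>_lim[OF elim(2)] s] \<sigma> by simp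
    ultimately have "(\<lambda>i. \<Phi> (\<sigma> i s) (r i s - g s) + \<Phi> (\<sigma> i s) (g s)) \<longlonglongrightarrow> 0 + \<Phi> s (g s)"
      by (rule tendsto_add)
    then show ?case by (simp add: blinfun.diff_right)
  qed
  ultimately show ?thesis
    unfolding strongly_measurable_def by (intro exI[of _ "\<lambda>i s. \<Phi> (\<sigma> i s) (r i s)"]) simp
next
  case False
  then show ?thesis
    unfolding strongly_measurable_def
    by (intro exI[of _ "\<lambda>_ _. 0"]) (auto simp: simple_function_def intro!: AE_I2)
qed

lemma finite_complete_measure_interval: "finite_complete_measure (lebesgue_on {a<..<b::real})"
proof (intro finite_complete_measure.intro)
  show "finite_measure (lebesgue_on {a<..<b})"
    by (intro finite_measureI) (cases "a \<le> b"; simp add: emeasure_restrict_space)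
  show "complete_measure (lebesgue_on {a<..<b})"
    by (intro complete_measure_restrict_space completion.complete_measure_axioms) simp
qed

locale control_system =
  fixes T :: real
    and S :: "real \<Rightarrow> real \<Rightarrow> 'y::banach \<Rightarrow>\<^sub>L 'y"
    and B :: "real \<Rightarrow> 'u::banach \<Rightarrow>\<^sub>L 'y"
  assumes T: "0 < T"
    and S: "evolution_operator T S"
    and B: "B \<in> Lp_space (lebesgue_on {0<..<T}) \<infinity>"
begin

abbreviation "\<mu> \<equiv> lebesgue_on {0<..<T}"

sublocale finite_complete_measure \<mu> by (rule finite_complete_measure_interval)

text \<open>The terminal value of the control-to-state map as a relation, for controls without integrability
conditions.\<close>
definition steers :: "(real \<Rightarrow> 'u) \<Rightarrow> 'y \<Rightarrow> bool" where
  "steers u x \<longleftrightarrow> has_strong_bochner_integral \<mu> (\<lambda>s. S T s (B s (u s))) x"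

lemma S_continuous: "t \<in> {0..T} \<Longrightarrow> continuous_on {0..t} (\<lambda>s. S t s y)"
proof -
  assume t: "t \<in> {0..T}"
  have "continuous_on {(t, s). 0 \<le> s \<and> s \<le> t \<and> t \<le> T} (\<lambda>(t, s). S t s y)"
    using S unfolding evolution_operator_def by blast
  then have "continuous_on (Pair t ` {0..t}) (\<lambda>(t, s). S t s y)"
    by (rule continuous_on_subset) (use t in auto)
  then have "continuous_on {0..t} ((\<lambda>(t, s). S t s y) \<circ> Pair t)"
    by (intro continuous_on_compose continuous_intros)
  then show ?thesis by (simp add: o_def)
qed

text \<open>\<open>S t\<close> is bounded on \<open>{0..t}\<close> and \<open>B\<close> is essentially bounded, so integrability of the control in the mean suffices for
the existence of the integral.\<close>
lemma integrand:
  assumes t: "t \<in> {0..T}"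
  shows "\<exists>C>0. \<forall>u. strongly_measurable \<mu> u \<longrightarrow>
    strongly_measurable (lebesgue_on {0<..<t}) (\<lambda>s. S t s (B s (u s))) \<and>
    (\<integral>\<^sup>+s. norm (S t s (B s (u s))) \<partial>lebesgue_on {0<..<t}) \<le> ennreal C * (\<integral>\<^sup>+s. norm (u s) \<partial>\<mu>)"
proof -
  let ?t = "lebesgue_on {0<..<t}"
  have sub: "{0<..<t} \<subseteq> {0<..<T}" using t by auto
  have res: "?t = restrict_space \<mu> {0<..<t}"
    using t by (simp add: restrict_restrict_space min_absorb2)
  have mt: "{0<..<t} \<in> sets \<mu>" using sub by (simp add: sets_restrict_space_iff)
  have mt': "{0<..<t} \<inter> space \<mu> \<in> sets \<mu>" using mt by (rule sets.Int) simp
  obtain C where C: "C > 0" "\<And>s. s \<in> {0..t} \<Longrightarrow> norm (S t s) \<le> C"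
    using strong_continuity_bounded[OF compact_Icc S_continuous[OF t]] by blast
  have mB: "strongly_measurable \<mu> B" using B by (simp add: Lp_space_def)
  obtain D where D: "D > 0" "Lp_bound \<mu> \<infinity> D B"
    using B Lp_space_iff_bound[of \<infinity> B] by auto
  then have nB: "AE s in \<mu>. norm (B s) \<le> D" by (simp add: Lp_bound_def)
  have "strongly_measurable ?t (\<lambda>s. S t s (B s (u s)))" if u: "strongly_measurable \<mu> u" for u
  proof (rule strongly_measurable_strongly_continuous)
    show "continuous_on {0..t} (\<lambda>s. S t s y)" for y by (rule S_continuous[OF t])
    have "strongly_measurable \<mu> (\<lambda>s. B s (u s))"
      by (rule strongly_measurable_compose2[OF mB u, where h = "\<lambda>b x. blinfun_apply b x"]) (rule blinfun.tendsto)
    then show "strongly_measurable ?t (\<lambda>s. B s (u s))"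
      unfolding res by (rule strongly_measurable_restrict_space[OF _ mt])
  qed
  moreover have "(\<integral>\<^sup>+s. norm (S t s (B s (u s))) \<partial>?t) \<le> ennreal (C * D) * (\<integral>\<^sup>+s. norm (u s) \<partial>\<mu>)"
    if u: "strongly_measurable \<mu> u" for u
  proof -
    have "(\<integral>\<^sup>+s. norm (S t s (B s (u s))) \<partial>?t)
        = (\<integral>\<^sup>+s. ennreal (norm (S t s (B s (u s)))) * indicator {0<..<t} s \<partial>\<mu>)"
      unfolding res by (rule nn_integral_restrict_space[OF mt'])
    also have "\<dots> \<le> (\<integral>\<^sup>+s. ennreal (norm ((C * D) *\<^sub>R u s)) \<partial>\<mu>)"
    proof (rule nn_integral_mono_AE, use nB in eventually_elim)
      case (elim s)
      have "norm (S t s (B s (u s))) \<le> norm ((C * D) *\<^sub>R u s)" if s: "s \<in> {0<..<t}"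
      proof -
        have "norm (S t s (B s (u s))) \<le> norm (S t s) * norm (B s (u s))" by (rule norm_blinfun)
        also have "\<dots> \<le> C * (D * norm (u s))"
          using C s elim order_trans[OF norm_blinfun mult_right_mono[OF elim norm_ge_zero]]
          by (intro mult_mono) auto
        finally show ?thesis using C D by (simp add: mult.assoc)
      qed
      then show ?case by (auto split: split_indicator intro: ennreal_leI)
    qed
    also have "\<dots> = ennreal (C * D) * (\<integral>\<^sup>+s. norm (u s) \<partial>\<mu>)"
      using C D by (subst nn_integral_norm_scaleR[OF u]) simp
    finally show ?thesis .
  qed
  ultimately show ?thesis using C D by (intro exI[of _ "C * D"]) auto
qed

lemma steers_add: "steers u x \<Longrightarrow> steers v y \<Longrightarrow> steers (\<lambda>s. u s + v s) (x + y)"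
  unfolding steers_def using has_integral_add by (fastforce simp: blinfun.add_right)

lemma steers_scaleR: "steers u x \<Longrightarrow> steers (\<lambda>s. c *\<^sub>R u s) (c *\<^sub>R x)"
  unfolding steers_def using has_integral_scaleR by (fastforce simp: blinfun.scaleR_right)

lemma steers_unique: "steers u x \<Longrightarrow> steers u y \<Longrightarrow> x = y"
  unfolding steers_def by (rule has_integral_unique)

context
  fixes p :: ereal
  assumes p: "1 < p"
begin

lemma mild_solution_exists:
  assumes u: "u \<in> Lp_space \<mu> p"
  shows "\<exists>y. mild_solution T S B u y"
proof -
  have m: "strongly_measurable \<mu> u" using u by (simp add: Lp_space_def)
  obtain c where c: "c > 0" "Lp_bound \<mu> p c u" using u Lp_space_iff_bound[OF p] by blast
  have "Lp_bound \<mu> p 1 (\<lambda>s. (1 / c) *\<^sub>R u s)" using Lp_bound_scaleR[OF c(2) p, of "1 / c"] c by simp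
  from nn_integral_norm_finite_of_Lp_bound[OF this p]
  have "ennreal \<bar>1 / c\<bar> * (\<integral>\<^sup>+s. norm (u s) \<partial>\<mu>) < \<infinity>" by (subst (asm) nn_integral_norm_scaleR[OF m])
  then have fin: "(\<integral>\<^sup>+s. norm (u s) \<partial>\<mu>) < \<infinity>" using c by (auto simp: ennreal_mult_less_top)
  have "\<exists>x. has_strong_bochner_integral (lebesgue_on {0<..<t}) (\<lambda>s. S t s (B s (u s))) x" if t: "t \<in> {0..T}" for t
  proof -
    obtain C where C: "strongly_measurable (lebesgue_on {0<..<t}) (\<lambda>s. S t s (B s (u s)))"
      "(\<integral>\<^sup>+s. norm (S t s (B s (u s))) \<partial>lebesgue_on {0<..<t}) \<le> ennreal C * (\<integral>\<^sup>+s. norm (u s) \<partial>\<mu>)"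
      using integrand[OF t] m by blast
    show ?thesis
      by (rule finite_complete_measure.has_integral_exists[OF finite_complete_measure_interval C(1)])
         (use C(2) fin in \<open>auto intro: le_less_trans simp: ennreal_mult_less_top\<close>)
  qed
  then show ?thesis unfolding mild_solution_def by metis
qed

text \<open>A control in the space has a mild solution on the whole interval, so only the integral over the
full interval matters for the set of final states.\<close>
lemma final_states_eq:
  assumes V: "V \<subseteq> Lp_space \<mu> p"
  shows "final_states T S B V = {x. \<exists>u\<in>V. steers u x}"
proof -
  have "steers u (y T)" if "mild_solution T S B u y" for u y
    using that T unfolding mild_solution_def steers_def by auto
  moreover have "\<exists>y. x = y T \<and> mild_solution T S B u y" if "u \<in> V" "steers u x" for u x
    using that V mild_solution_exists[of u] calculation steers_unique by blast
  ultimately show ?thesis unfolding final_states_def by blast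
qed

lemma steers_exists: "u \<in> Lp_space \<mu> p \<Longrightarrow> \<exists>x. steers u x"
  using mild_solution_exists[of u] T unfolding mild_solution_def steers_def by auto

lemma norm_steers_le: "\<exists>C>0. \<forall>u x. Lp_bound \<mu> p 1 u \<longrightarrow> steers u x \<longrightarrow> norm x \<le> C"
proof -
  obtain C where C: "C > 0" "\<And>u. strongly_measurable \<mu> u \<Longrightarrow>
    (\<integral>\<^sup>+s. norm (S T s (B s (u s))) \<partial>\<mu>) \<le> ennreal C * (\<integral>\<^sup>+s. norm (u s) \<partial>\<mu>)"
    using integrand[of T] T by auto
  define D where "D = measure \<mu> (space \<mu>)"
  have "norm x \<le> C * (1 + D)" if u: "Lp_bound \<mu> p 1 u" and x: "steers u x" for u x
  proof -
    have "ennreal (norm x) \<le> ennreal C * (\<integral>\<^sup>+s. norm (u s) \<partial>\<mu>)"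
      using norm_integral_le[OF x[unfolded steers_def]] C(2)[of u] u
      by (auto simp: Lp_bound_def intro: order_trans)
    also have "\<dots> \<le> ennreal C * (1 + emeasure \<mu> (space \<mu>))"
      by (intro mult_left_mono nn_integral_norm_le_of_Lp_bound[OF u p]) simp
    also have "\<dots> = ennreal (C * (1 + D))"
      using C(1) by (simp add: D_def emeasure_eq_measure ennreal_mult)
    finally show ?thesis using C(1) by (simp add: D_def)
  qed
  then show ?thesis using C(1) by (intro exI[of _ "C * (1 + D)"]) (auto simp: D_def add_pos_nonneg)
qed

definition reach_disk :: "'y set" where
  "reach_disk = {x. \<exists>u. Lp_bound \<mu> p 1 u \<and> steers u x}"

lemma Lp_bound_Lp_space: "Lp_bound \<mu> p 1 u \<Longrightarrow> u \<in> Lp_space \<mu> p"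
  using Lp_space_iff_bound[OF p] zero_less_one by blast

text \<open>The map from controls to final states sends dyadic series to dyadic series, because the magnified
remainders of a dyadic series of controls stay in the unit ball and final states of controls from
the unit ball are bounded.\<close>
lemma banach_disk_reach_disk: "banach_disk reach_disk"
proof
  obtain x where "steers (\<lambda>_. 0) x"
    using steers_exists[OF Lp_bound_Lp_space[OF Lp_bound_zero]] by auto
  then show "reach_disk \<noteq> {}" using Lp_bound_zero[of 1 p] unfolding reach_disk_def by auto
next
  show "convex reach_disk"
  proof (rule convexI)
    fix x y and a b :: real assume "x \<in> reach_disk" "y \<in> reach_disk" and ab: "0 \<le> a" "0 \<le> b" "a + b = 1"
    then obtain u v where "Lp_bound \<mu> p 1 u" "steers u x" "Lp_bound \<mu> p 1 v" "steers v y"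
      unfolding reach_disk_def by blast
    then have "Lp_bound \<mu> p 1 (\<lambda>s. a *\<^sub>R u s + b *\<^sub>R v s)"
        "steers (\<lambda>s. a *\<^sub>R u s + b *\<^sub>R v s) (a *\<^sub>R x + b *\<^sub>R y)"
      using ab by (auto intro!: Lp_bound_convex p steers_add steers_scaleR)
    then show "a *\<^sub>R x + b *\<^sub>R y \<in> reach_disk" unfolding reach_disk_def by blast
  qed
next
  fix c x assume c: "\<bar>c\<bar> \<le> (1::real)" and "x \<in> reach_disk"
  then obtain u where u: "Lp_bound \<mu> p 1 u" "steers u x" unfolding reach_disk_def by blast
  \<comment> \<open>\<open>c *\<^sub>R u\<close> is a convex combination of \<open>u\<close> and \<open>- u\<close>\<close>
  have "Lp_bound \<mu> p 1 (\<lambda>s. (-1) *\<^sub>R u s)" using Lp_bound_scaleR[OF u(1) p, of "-1"] by simp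
  have half: "(1 + c) / 2 - (1 - c) / 2 = c" by (simp add: field_simps)
  from Lp_bound_convex[OF u(1) \<open>Lp_bound \<mu> p 1 (\<lambda>s. (-1) *\<^sub>R u s)\<close> p, of "(1 + c) / 2" "(1 - c) / 2"]
  have "Lp_bound \<mu> p 1 (\<lambda>s. c *\<^sub>R u s)"
    using c by (simp add: abs_le_iff add_divide_distrib[symmetric] scaleR_left_diff_distrib[symmetric] half)
  with steers_scaleR[OF u(2), of c] show "c *\<^sub>R x \<in> reach_disk" unfolding reach_disk_def by blast
next
  fix x :: "nat \<Rightarrow> 'y" assume "\<And>n. x n \<in> reach_disk"
  then have "\<forall>n. \<exists>u. Lp_bound \<mu> p 1 u \<and> steers u (x n)" unfolding reach_disk_def by blast
  then obtain u where u: "\<And>n. Lp_bound \<mu> p 1 (u n)" "\<And>n. steers (u n) (x n)" by metis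
  obtain v where v: "\<And>N. Lp_bound \<mu> p 1 (\<lambda>s. 2 ^ N *\<^sub>R (v s - (\<Sum>n<N. (1/2) ^ Suc n *\<^sub>R u n s)))"
    using Lp_dyadic_series[of p u, OF u(1) p] by blast
  from v[of 0] have v0: "Lp_bound \<mu> p 1 v" by simp
  then obtain y where y: "steers v y" using steers_exists Lp_bound_Lp_space by blast
  obtain C where C: "\<And>u x. Lp_bound \<mu> p 1 u \<Longrightarrow> steers u x \<Longrightarrow> norm x \<le> C"
    using norm_steers_le by blast
  have zero: "steers (\<lambda>_. 0) 0"
    using steers_scaleR[OF y, of 0] by simp
  have part: "steers (\<lambda>s. \<Sum>n<N. (1/2) ^ Suc n *\<^sub>R u n s) (\<Sum>n<N. (1/2) ^ Suc n *\<^sub>R x n)" for N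
  proof (induction N)
    case (Suc N)
    from steers_add[OF Suc steers_scaleR[OF u(2), of "(1/2) ^ Suc N" N]] show ?case by simp
  qed (simp add: zero)
  have bound: "norm (y - (\<Sum>n<N. (1/2) ^ Suc n *\<^sub>R x n)) \<le> (1/2) ^ N * C" for N
  proof -
    have "steers (\<lambda>s. 2 ^ N *\<^sub>R (v s + (-1) *\<^sub>R (\<Sum>n<N. (1/2) ^ Suc n *\<^sub>R u n s)))
       (2 ^ N *\<^sub>R (y + (-1) *\<^sub>R (\<Sum>n<N. (1/2) ^ Suc n *\<^sub>R x n)))"
      by (intro steers_scaleR steers_add y part)
    then have "norm (2 ^ N *\<^sub>R (y - (\<Sum>n<N. (1/2) ^ Suc n *\<^sub>R x n))) \<le> C"
      by (intro C[OF v[of N]]) (simp del: power_Suc)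
    then have "2 ^ N * norm (y - (\<Sum>n<N. (1/2) ^ Suc n *\<^sub>R x n)) \<le> C"
      by (simp only: norm_scaleR power_abs abs_numeral)
    moreover have "d \<le> (1/2) ^ N * C" if "2 ^ N * d \<le> C" for d :: real
      using that by (simp add: power_one_over field_simps)
    ultimately show ?thesis by blast
  qed
  have "(\<lambda>N. y - (\<Sum>n<N. (1/2) ^ Suc n *\<^sub>R x n)) \<longlonglongrightarrow> 0"
  proof (rule Lim_null_comparison)
    show "(\<lambda>N. (1/2) ^ N * C) \<longlonglongrightarrow> 0"
      by (intro tendsto_mult_left_zero LIMSEQ_realpow_zero) auto
  qed (use bound in simp)
  then have "(\<lambda>n. (1/2) ^ Suc n *\<^sub>R x n) sums y"
    unfolding sums_def by (rule Lim_transform2[OF tendsto_const])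
  then show "\<exists>y\<in>reach_disk. (\<lambda>n. (1/2) ^ Suc n *\<^sub>R x n) sums y"
    using v0 y unfolding reach_disk_def by blast
qed

lemma bounded_control_multiple:
  assumes "Lp_bound \<mu> p c u" "0 < c" "steers u x"
  shows "\<exists>k\<in>reach_disk. x = c *\<^sub>R k"
proof -
  have "Lp_bound \<mu> p 1 (\<lambda>s. (1 / c) *\<^sub>R u s)"
    using Lp_bound_scaleR[OF assms(1) p, of "1 / c"] assms(2) by simp
  then have "(1 / c) *\<^sub>R x \<in> reach_disk"
    using steers_scaleR[OF assms(3)] unfolding reach_disk_def by blast
  then show ?thesis using assms(2) by (intro bexI[of _ "(1 / c) *\<^sub>R x"]) auto
qed

lemma reachable_eq_span: "final_states T S B (Lp_space \<mu> p) = span reach_disk"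
proof -
  have "x \<in> span reach_disk" if "u \<in> Lp_space \<mu> p" "steers u x" for u x
    using that bounded_control_multiple[of _ u x] Lp_space_iff_bound[OF p]
    by (metis span_base span_scale)
  moreover have "\<exists>u\<in>Lp_space \<mu> p. steers u x" if "x \<in> span reach_disk" for x
  proof -
    obtain n k where "k \<in> reach_disk" "x = real n *\<^sub>R k"
      using banach_disk.span_eq_multiples[OF banach_disk_reach_disk \<open>x \<in> span reach_disk\<close>] by blast
    then show ?thesis
      unfolding reach_disk_def using steers_scaleR Lp_space_scaleR[OF p] Lp_bound_Lp_space by blast
  qed
  ultimately show ?thesis unfolding final_states_eq[OF subset_refl] by blast
qed

end

end

section \<open>Finite codimensional exact controllability\<close>
lemma (in control_system) final_states_bounded_subset:
  assumes p: "1 < p" and U: "U \<subseteq> Lp_space \<mu> p" "Lp_bounded \<mu> p U"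
  shows "\<exists>c. \<forall>x\<in>final_states T S B U. \<exists>k\<in>reach_disk p. x = c *\<^sub>R k"
proof -
  obtain C where C: "\<And>u. u \<in> U \<Longrightarrow> Lp_norm \<mu> p u \<le> C" using U(2) unfolding Lp_bounded_def by blast
  have "Lp_bound \<mu> p (max C 1) u" if "u \<in> U" for u
    using that U(1) C[OF that] by (subst Lp_bound_iff[OF p]) auto
  then have "\<exists>k\<in>reach_disk p. x = max C 1 *\<^sub>R k" if "u \<in> U" "steers u x" for u x
    using that by (intro bounded_control_multiple[OF p]) auto
  then show ?thesis
    unfolding final_states_eq[OF p U(1)] by (intro exI[of _ "max C 1"]) blast
qed

text \<open>The control-to-state map is linear on the space only, hence the image of the convex hull is
computed by exhibiting a convex set that contains \<open>U\<close>.\<close>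
lemma (in control_system) convex_hull_steers:
  assumes p: "1 < p" and U: "U \<subseteq> Lp_space \<mu> p" and w: "w \<in> convex hull U"
  shows "w \<in> Lp_space \<mu> p \<and> (\<forall>x. steers w x \<longrightarrow> x \<in> convex hull (final_states T S B U))"
    (is "?P w")
proof -
  have "convex hull U \<subseteq> Collect ?P"
  proof (rule hull_minimal)
    show "U \<subseteq> Collect ?P"
      using U unfolding final_states_eq[OF p U] by (auto intro: hull_inc)
    show "convex (Collect ?P)"
    proof (rule convexI)
      fix u v and a b :: real
      assume u: "u \<in> Collect ?P" and v: "v \<in> Collect ?P" and ab: "0 \<le> a" "0 \<le> b" "a + b = 1"
      obtain x y where x: "steers u x" and y: "steers v y"
        using u v steers_exists[OF p] by blast
      have comb: "a *\<^sub>R u + b *\<^sub>R v = (\<lambda>s. a *\<^sub>R u s + b *\<^sub>R v s)"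
        by (simp add: fun_eq_iff scaleR_fun_def)
      have "(\<lambda>s. a *\<^sub>R u s + b *\<^sub>R v s) \<in> Lp_space \<mu> p"
        using u v by (intro Lp_space_add Lp_space_scaleR p) auto
      moreover have "z = a *\<^sub>R x + b *\<^sub>R y" if "steers (\<lambda>s. a *\<^sub>R u s + b *\<^sub>R v s) z" for z
        by (rule steers_unique[OF that steers_add[OF steers_scaleR[OF x] steers_scaleR[OF y]]])
      moreover have "a *\<^sub>R x + b *\<^sub>R y \<in> convex hull (final_states T S B U)"
        using u v x y ab by (intro convexD[OF convex_convex_hull]) auto
      ultimately show "a *\<^sub>R u + b *\<^sub>R v \<in> Collect ?P"
        unfolding comb by blast
    qed
  qed
  with w show ?thesis by blast
qed

text \<open>Continuity of the control-to-state map, which is boundedness of the disk of final states.\<close>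
lemma (in control_system) steers_Lp_closure:
  assumes p: "1 < p" and U: "U \<subseteq> Lp_space \<mu> p"
    and v: "v \<in> Lp_closure \<mu> p (convex hull U)" "steers v y"
  shows "y \<in> closure (convex hull (final_states T S B U))"
proof -
  obtain C where C: "C > 0" "\<And>k. k \<in> reach_disk p \<Longrightarrow> norm k \<le> C"
    using banach_disk.bounded[OF banach_disk_reach_disk[OF p]] by blast
  have "\<exists>z\<in>convex hull (final_states T S B U). dist z y < e" if e: "e > 0" for e
  proof -
    have "e / (2 * C) > 0" using e C by simp
    then obtain w where w: "w \<in> convex hull U" "Lp_norm \<mu> p (v - w) < e / (2 * C)"
      using v(1) unfolding Lp_closure_def by blast
    note w' = convex_hull_steers[OF p U w(1)]
    obtain z where z: "steers w z" using w' steers_exists[OF p] by blast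
    have vw: "v - w = (\<lambda>s. v s + (-1) *\<^sub>R w s)" by (simp add: fun_eq_iff)
    have "v - w \<in> Lp_space \<mu> p"
      using v(1) w' unfolding vw by (intro Lp_space_add Lp_space_scaleR p) (auto simp: Lp_closure_def)
    then have "Lp_bound \<mu> p (e / (2 * C)) (v - w)"
      using w(2) e C by (subst Lp_bound_iff[OF p]) auto
    moreover have "steers (v - w) (y + (-1) *\<^sub>R z)"
      unfolding vw by (intro steers_add steers_scaleR v z)
    ultimately obtain k where k: "k \<in> reach_disk p" "y + (-1) *\<^sub>R z = (e / (2 * C)) *\<^sub>R k"
      using bounded_control_multiple[OF p] e C by (metis \<open>e / (2 * C) > 0\<close>)
    have "dist z y = norm (y + (-1) *\<^sub>R z)" by (simp add: dist_norm norm_minus_commute)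
    also have "\<dots> = e / (2 * C) * norm k" unfolding k(2) using e C by simp
    also have "\<dots> \<le> e / (2 * C) * C" using e C k(1) by (intro mult_left_mono) auto
    also have "\<dots> < e" using e C by simp
    finally show ?thesis using w' z by blast
  qed
  then show ?thesis unfolding closure_approachable by blast
qed

theorem theorem3p1:
  fixes T :: real and p :: ereal
    and DA :: "'y::banach set" and A :: "'y \<Rightarrow> 'y" and G :: "real \<Rightarrow> 'y \<Rightarrow>\<^sub>L 'y"
    and F :: "real \<Rightarrow> 'y \<Rightarrow>\<^sub>L 'y" and B :: "real \<Rightarrow> 'u::banach \<Rightarrow>\<^sub>L 'y"
    and S :: "real \<Rightarrow> real \<Rightarrow> 'y \<Rightarrow>\<^sub>L 'y"
    and U :: "(real \<Rightarrow> 'u) set" and M :: "'y set"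
  assumes "T > 0" and "1 < p"
    and "reflexive_space TYPE('y)" and "reflexive_space TYPE('u)"
    and "generates_C0_semigroup DA A G"
    and "F \<in> Lp_space (lebesgue_on {0<..<T}) \<infinity>"
    and "B \<in> Lp_space (lebesgue_on {0<..<T}) \<infinity>"
    and "generates_evolution_operator T G F S"
    and "U \<noteq> {}" and "U \<subseteq> Lp_space (lebesgue_on {0<..<T}) p"
    and "Lp_bounded (lebesgue_on {0<..<T}) p U"
    and "Lp_interior (lebesgue_on {0<..<T}) p
           (Lp_closure (lebesgue_on {0<..<T}) p (convex hull U)) \<noteq> {}"
    and "M = final_states T S B U"
  shows "finite_codim_exactly_controllable T p S B \<longleftrightarrow> finite_codim_set M"
proof -
  note p = assms(2)
  let ?\<mu> = "lebesgue_on {0<..<T}"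
  interpret control_system T S B
    using assms(1,7,8) by unfold_locales (auto simp: generates_evolution_operator_def)
  interpret K: banach_disk "reach_disk p" by (rule banach_disk_reach_disk[OF p])
  have R: "final_states T S B (Lp_space ?\<mu> p) = span (reach_disk p)" by (rule reachable_eq_span[OF p])
  have MR: "M \<subseteq> span (reach_disk p)"
    unfolding assms(13) R[symmetric] using assms(10) by (auto simp: final_states_def)
  show ?thesis
    unfolding finite_codim_exactly_controllable_def R
  proof
    assume fin: "finite_codim_set M"
    obtain c where "\<And>x. x \<in> M \<Longrightarrow> \<exists>k\<in>reach_disk p. x = c *\<^sub>R k"
      using final_states_bounded_subset[OF p assms(10,11)] assms(13) by blast
    then show "finite_codim_subspace (span (reach_disk p))"
      using fin by (rule K.finite_codim_span_of_set)
  next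
    assume fin: "finite_codim_subspace (span (reach_disk p))"
    let ?V = "Lp_closure ?\<mu> p (convex hull U)"
    obtain u r where u: "u \<in> Lp_space ?\<mu> p" and r: "r > 0"
      and int: "\<And>v. v \<in> Lp_space ?\<mu> p \<Longrightarrow> Lp_norm ?\<mu> p (v - u) < r \<Longrightarrow> v \<in> ?V"
      using assms(12) unfolding Lp_interior_def by blast
    obtain y where y: "steers u y" using steers_exists[OF p u] by blast
    have yk: "y + (r / 2) *\<^sub>R k \<in> closure (convex hull M)" if k: "k \<in> reach_disk p" for k
    proof -
      obtain v where v: "Lp_bound ?\<mu> p 1 v" "steers v k" using k unfolding reach_disk_def[OF p] by blast
      define w where "w = (\<lambda>s. u s + (r / 2) *\<^sub>R v s)"
      have "Lp_bound ?\<mu> p (r / 2) (\<lambda>s. (r / 2) *\<^sub>R v s)"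
        using Lp_bound_scaleR[OF v(1) p, of "r / 2"] r by simp
      moreover have "w - u = (\<lambda>s. (r / 2) *\<^sub>R v s)" by (simp add: w_def fun_eq_iff)
      ultimately have "Lp_norm ?\<mu> p (w - u) \<le> r / 2"
        using Lp_bound_iff[OF p, of "r / 2" "w - u"] r by simp
      then have "Lp_norm ?\<mu> p (w - u) < r" using r by linarith
      moreover have "w \<in> Lp_space ?\<mu> p"
        unfolding w_def by (intro Lp_space_add Lp_space_scaleR p u Lp_bound_Lp_space[OF p] v)
      ultimately have "w \<in> ?V" by (intro int)
      moreover have "steers w (y + (r / 2) *\<^sub>R k)"
        unfolding w_def by (intro steers_add steers_scaleR y v)
      ultimately show ?thesis
        unfolding assms(13) by (rule steers_Lp_closure[OF p assms(10)])
    qed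
    obtain k where k: "k \<in> reach_disk p" using K.nonempty by blast
    have "0 \<in> reach_disk p" using K.balanced[of 0, OF _ k] by simp
    from yk[OF this] have "y \<in> closure (convex hull M)" by simp
    moreover have "y \<in> span (reach_disk p)"
      unfolding R[symmetric] final_states_eq[OF p subset_refl] using u y by blast
    ultimately show "finite_codim_set M"
      using yk r MR by (intro K.finite_codim_set_of_span[OF fin, of M y "r / 2"]) auto
  qed
qed

end
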